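(* Let $\mu$ be a measure on $\mathbf{R}$ and $1<p<\infty$. Assume that $d\mu=w\,dx$ and $w,\,w^{1/(1-p)}\in L^1_{\rm loc}(I)$ for some (not necessarily open) interval $I\subset\mathbf{R}$. Then every $u\in N^{1,p}_{\rm loc}(I,\mu)$ is locally absolutely continuous on $I$ and $g_u=|u'|$ a.e. on $I$, where $g_u$ is the minimal $p$-weak upper gradient of $u$.
   Context: A measure on $\mathbf{R}$ means a positive complete Borel measure $\mu$ with $0<\mu(B)<\infty$ for every bounded nonempty open interval $B$. The interval $I$ (nondegenerate) is regarded as a metric space with the Euclidean distance and the measure $\mu|_I$. Upper gradient: a Borel function $g\ge 0$ on a metric space $Y$ is an upper gradient of $u:Y\to[-\infty,\infty]$ if $$|u(\gamma(0))-u(\gamma(l_\gamma))|\le\int_\gamma g\,ds \qquad ( * )$$ for every nonconstant compact rectifiable curve $\gamma:[0,l_\gamma]\to Y$ parameterized by arc length (the left-hand side is interpreted as $\infty$ if at least one of the two terms is $\pm\infty$). A nonnegative measurable function $g$ is a $p$-weak upper gradient of $u$ if $( * )$ holds for $p$-almost every curve, i.e. for all such curves except those in a family $\Gamma$ for which there is a Borel function $0\le\rho\in L^p(Y)$ with $\int_\gamma\rho\,ds=\infty$ for every $\gamma\in\Gamma$. If $u$ has an upper gradient in $L^p_{\rm loc}(Y)$, then it has a minimal $p$-weak upper gradient $g_u\in L^p_{\rm loc}(Y)$, i.e. a $p$-weak upper gradient such that $g_u\le g$ a.e. for every $p$-weak upper gradient $g\in L^p_{\rm loc}(Y)$ of $u$;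 it is unique up to sets of measure zero. The Newtonian space $N^{1,p}(Y,\mu)$ consists of all measurable functions $u:Y\to[-\infty,\infty]$ (defined at every point, not just up to a.e. equivalence) having an upper gradient in $L^p(Y)$ and such that $\int_Y|u|^p\,d\mu+\int_Y g_u^p\,d\mu<\infty$. The subscript "loc" means: every $x\in I$ has a relatively open neighbourhood in $I$ on which the function belongs to the corresponding space. Locally absolutely continuous on $I$ means absolutely continuous on every compact subinterval of $I$. *)

theory Defs
  imports "HOL-Analysis.Analysis"
begin

text \<open>
  A positive complete Borel measure is a completion of a measure on the Borel sets;
  balls in \<open>\<real>\<close> are the bounded nonempty open intervals.
\<close>

definition measure_on_R :: "real measure \<Rightarrow> bool" where
  "measure_on_R M \<longleftrightarrow>
     (\<exists>N. sets N = sets borel \<and> M = completion N) \<and>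
     (\<forall>a b. a < b \<longrightarrow> 0 < emeasure M {a<..<b} \<and> emeasure M {a<..<b} < \<infinity>)"

text \<open>
  Real powers on \<open>[0,\<infinity>]\<close>. The point is that \<open>0\<close> and \<open>\<infinity>\<close> are interchanged by negative
  exponents, whereas \<open>0 powr a = 0\<close> for reals.
\<close>

definition epow :: "ennreal \<Rightarrow> real \<Rightarrow> ennreal" where
  "epow x a =
     (if a = 0 then 1
      else if x = 0 then (if a < 0 then \<infinity> else 0)
      else if x = \<infinity> then (if a < 0 then 0 else \<infinity>)
      else ennreal (enn2real x powr a))"

text \<open>
  Throughout, \<open>Y\<close> is a subset of a metric space, itself regarded as a metric space with the
  measure \<open>restrict_space M Y\<close>; functions are total and only their values on \<open>Y\<close> matter.
\<close>

definition near_each_point :: "'a::topological_space set \<Rightarrow> ('a set \<Rightarrow> bool) \<Rightarrow> bool" where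
  "near_each_point Y P \<longleftrightarrow> (\<forall>x\<in>Y. \<exists>G. openin (top_of_set Y) G \<and> x \<in> G \<and> P G)"

definition in_Lp :: "real \<Rightarrow> 'a measure \<Rightarrow> 'a set \<Rightarrow> ('a \<Rightarrow> ennreal) \<Rightarrow> bool" where
  "in_Lp p M Y f \<longleftrightarrow>
     f \<in> borel_measurable (restrict_space M Y) \<and>
     (\<integral>\<^sup>+x. epow (f x) p \<partial>restrict_space M Y) < \<infinity>"

definition in_Lp_loc :: "real \<Rightarrow> 'a::topological_space measure \<Rightarrow> 'a set \<Rightarrow> ('a \<Rightarrow> ennreal) \<Rightarrow> bool" where
  "in_Lp_loc p M Y f \<longleftrightarrow> near_each_point Y (\<lambda>G. in_Lp p M G f)"

definition curve_length :: "(real \<Rightarrow> 'a::metric_space) \<Rightarrow> real \<Rightarrow> real \<Rightarrow> ennreal" where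
  "curve_length \<gamma> a b =
     (SUP (n, t) \<in> {(n::nat, t). mono_on {..n} t \<and> t ` {..n} \<subseteq> {a..b}}.
        \<Sum>i<n. ennreal (dist (\<gamma> (t i)) (\<gamma> (t (Suc i)))))"

text \<open>
  Compact rectifiable curves \<open>\<gamma> : [0,l] \<rightarrow> Y\<close> parameterized by arc length; such a curve is
  nonconstant iff \<open>l > 0\<close>.
\<close>

definition arc_length_curve :: "'a::metric_space set \<Rightarrow> (real \<Rightarrow> 'a) \<Rightarrow> real \<Rightarrow> bool" where
  "arc_length_curve Y \<gamma> l \<longleftrightarrow>
     0 < l \<and> continuous_on {0..l} \<gamma> \<and> \<gamma> ` {0..l} \<subseteq> Y \<and>
     (\<forall>s t. 0 \<le> s \<longrightarrow> s \<le> t \<longrightarrow> t \<le> l \<longrightarrow> curve_length \<gamma> s t = ennreal (t - s))"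

definition line_integral :: "('a \<Rightarrow> ennreal) \<Rightarrow> (real \<Rightarrow> 'a) \<Rightarrow> real \<Rightarrow> ennreal" where
  "line_integral g \<gamma> l = (\<integral>\<^sup>+s. g (\<gamma> s) \<partial>lebesgue_on {0..l})"

text \<open>\<open>|a - b|\<close>, read as \<open>\<infinity>\<close> if at least one of the terms is infinite\<close>

definition ereal_gap :: "ereal \<Rightarrow> ereal \<Rightarrow> ennreal" where
  "ereal_gap a b = (if \<bar>a\<bar> = \<infinity> \<or> \<bar>b\<bar> = \<infinity> then \<infinity> else e2ennreal \<bar>a - b\<bar>)"

text \<open>
  The upper gradient inequality along one curve. The measurability clause says that the line
  integral makes sense: it is automatic for Borel \<open>g\<close>, and holds along \<open>p\<close>-almost every curve if
  \<open>g\<close> is measurable with respect to the completion of a Borel measure.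
\<close>

definition ug_inequality :: "('a \<Rightarrow> ereal) \<Rightarrow> ('a \<Rightarrow> ennreal) \<Rightarrow> (real \<Rightarrow> 'a) \<Rightarrow> real \<Rightarrow> bool" where
  "ug_inequality u g \<gamma> l \<longleftrightarrow>
     (\<lambda>s. g (\<gamma> s)) \<in> borel_measurable (lebesgue_on {0..l}) \<and>
     ereal_gap (u (\<gamma> 0)) (u (\<gamma> l)) \<le> line_integral g \<gamma> l"

definition upper_gradient :: "'a::metric_space set \<Rightarrow> ('a \<Rightarrow> ereal) \<Rightarrow> ('a \<Rightarrow> ennreal) \<Rightarrow> bool" where
  "upper_gradient Y u g \<longleftrightarrow>
     g \<in> borel_measurable (restrict_space borel Y) \<and>
     (\<forall>\<gamma> l. arc_length_curve Y \<gamma> l \<longrightarrow> ug_inequality u g \<gamma> l)"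

definition exceptional_family ::
  "real \<Rightarrow> 'a::metric_space measure \<Rightarrow> 'a set \<Rightarrow> ((real \<Rightarrow> 'a) \<times> real) set \<Rightarrow> bool" where
  "exceptional_family p M Y \<Gamma> \<longleftrightarrow>
     (\<exists>\<rho>. \<rho> \<in> borel_measurable (restrict_space borel Y) \<and> in_Lp p M Y \<rho> \<and>
          (\<forall>(\<gamma>, l) \<in> \<Gamma>. line_integral \<rho> \<gamma> l = \<infinity>))"

definition weak_upper_gradient ::
  "real \<Rightarrow> 'a::metric_space measure \<Rightarrow> 'a set \<Rightarrow> ('a \<Rightarrow> ereal) \<Rightarrow> ('a \<Rightarrow> ennreal) \<Rightarrow> bool" where
  "weak_upper_gradient p M Y u g \<longleftrightarrow>
     g \<in> borel_measurable (restrict_space M Y) \<and>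
     exceptional_family p M Y {(\<gamma>, l). arc_length_curve Y \<gamma> l \<and> \<not> ug_inequality u g \<gamma> l}"

definition is_minimal_weak_upper_gradient ::
  "real \<Rightarrow> 'a::metric_space measure \<Rightarrow> 'a set \<Rightarrow> ('a \<Rightarrow> ereal) \<Rightarrow> ('a \<Rightarrow> ennreal) \<Rightarrow> bool" where
  "is_minimal_weak_upper_gradient p M Y u g \<longleftrightarrow>
     weak_upper_gradient p M Y u g \<and> in_Lp_loc p M Y g \<and>
     (\<forall>h. weak_upper_gradient p M Y u h \<and> in_Lp_loc p M Y h \<longrightarrow>
          (AE x in restrict_space M Y. g x \<le> h x))"

text \<open>The function \<open>g\<^sub>u\<close>, which is unique only up to null sets: an arbitrary representative\<close>

definition minimal_weak_upper_gradient ::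
  "real \<Rightarrow> 'a::metric_space measure \<Rightarrow> 'a set \<Rightarrow> ('a \<Rightarrow> ereal) \<Rightarrow> 'a \<Rightarrow> ennreal" where
  "minimal_weak_upper_gradient p M Y u = (SOME g. is_minimal_weak_upper_gradient p M Y u g)"

definition Newtonian :: "real \<Rightarrow> 'a::metric_space measure \<Rightarrow> 'a set \<Rightarrow> ('a \<Rightarrow> ereal) \<Rightarrow> bool" where
  "Newtonian p M Y u \<longleftrightarrow>
     u \<in> borel_measurable (restrict_space M Y) \<and>
     (\<exists>g. upper_gradient Y u g \<and> in_Lp p M Y g) \<and>
     (\<integral>\<^sup>+x. epow (e2ennreal \<bar>u x\<bar>) p \<partial>restrict_space M Y) +
     (\<integral>\<^sup>+x. epow (minimal_weak_upper_gradient p M Y u x) p \<partial>restrict_space M Y) < \<infinity>"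

definition Newtonian_loc :: "real \<Rightarrow> 'a::metric_space measure \<Rightarrow> 'a set \<Rightarrow> ('a \<Rightarrow> ereal) \<Rightarrow> bool" where
  "Newtonian_loc p M Y u \<longleftrightarrow> near_each_point Y (\<lambda>G. Newtonian p M G u)"

definition abs_continuous_on :: "real \<Rightarrow> real \<Rightarrow> (real \<Rightarrow> real) \<Rightarrow> bool" where
  "abs_continuous_on a b f \<longleftrightarrow>
     (\<forall>\<epsilon>>0. \<exists>\<delta>>0. \<forall>(n::nat) s t.
        (\<forall>i<n. a \<le> s i \<and> s i \<le> t i \<and> t i \<le> b) \<and>
        disjoint_family_on (\<lambda>i. {s i<..<t i}) {..<n} \<and>
        (\<Sum>i<n. t i - s i) < \<delta> \<longrightarrow>
        (\<Sum>i<n. \<bar>f (t i) - f (s i)\<bar>) < \<epsilon>)"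

definition loc_abs_continuous_on :: "real set \<Rightarrow> (real \<Rightarrow> ereal) \<Rightarrow> bool" where
  "loc_abs_continuous_on I u \<longleftrightarrow>
     (\<forall>x\<in>I. \<bar>u x\<bar> \<noteq> \<infinity>) \<and>
     (\<forall>a b. a \<le> b \<and> {a..b} \<subseteq> I \<longrightarrow> abs_continuous_on a b (\<lambda>x. real_of_ereal (u x)))"

end

theory Submission
  imports Defs "HOL-Probability.Distribution_Functions"
begin

text \<open>
  Since \<open>g \<le> w * g powr p + w powr (1 / (1 - p))\<close> pointwise, functions in \<open>L\<^sup>p(w dx)\<close> are
  Lebesgue integrable on compact subintervals of \<open>I\<close>. Hence no segment is exceptional, and every
  \<open>p\<close>-weak upper gradient \<open>k\<close> satisfies \<open>|u(y) - u(x)| \<le> \<integral>\<^sub>x\<^sup>y k dt < \<infinity>\<close>, first locally and then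
  on all compact subintervals. This gives absolute continuity. It also gives \<open>u' = f\<close> a.e. for the
  density \<open>f\<close> provided by the theorem of Radon and Nikodym, and \<open>|u'| \<le> k\<close> a.e., both by Lebesgue's
  differentiation theorem. Conversely a Borel representative of \<open>|u'|\<close> is an upper gradient: a
  curve parametrized by arc length is 1-Lipschitz and crosses everything between its end points,
  so that its line integrals dominate the integral over the segment between them.
\<close>

section \<open>Comparison of measures and zero density\<close>

text \<open>Two obstacles shape the proof. The first: the theorem of Radon and Nikodym needs a
  measure, while \<open>u\<close> need not be monotone. Adding a primitive of the dominating
  function makes it monotone; its Stieltjes measure then lies below twice the dominating density.
  This comparison, like the one for push-forwards along curves, is known only on half-open
  intervals, and an inequality does not survive the passage to complements. So it is first turned
  into an equation with a third measure. The second is measurability. \<open>M\<close> is a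
  completion, and on \<open>I\<close> its null sets are the Lebesgue null sets because integrability
  of the negative power of \<open>w\<close> forces \<open>w > 0\<close> almost everywhere. An upper
  gradient has to be Borel and defined at every point, whence the limsup of difference quotients
  that stands for \<open>|u'|\<close>. That it lies locally in L^p follows by comparison: near each
  point it is a.e. at most any upper gradient of \<open>u\<close> in L^p.\<close>

lemma UN_Ioc_real_of_nat: "(\<Union>n::nat. {- real n<..real n}) = UNIV"
proof -
  have "\<exists>n::nat. - real n < x \<and> x \<le> real n" for x
  proof -
    obtain n :: nat where "\<bar>x\<bar> < real n" using reals_Archimedean2 by blast
    then show ?thesis by (intro exI[of _ n]) auto
  qed
  then show ?thesis by auto
qed

text \<open>The difference \<open>F\<close> of the distribution functions is nondecreasing and right
  continuous, so it has a Stieltjes measure \<open>\<kappa>\<close>, and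
  \<open>\<kappa> + \<mu> = \<nu>\<close> on half-open intervals. Unlike the inequality, this
  equation extends to all Borel sets by the pi-lambda argument.\<close>

lemma emeasure_le_if_le_on_Ioc:
  fixes \<mu> \<nu> :: "real measure"
  assumes "finite_borel_measure \<mu>" "finite_borel_measure \<nu>"
    and le: "\<And>c d. c \<le> d \<Longrightarrow> emeasure \<mu> {c<..d} \<le> emeasure \<nu> {c<..d}"
  shows "\<mu> \<le> \<nu>"
proof -
  interpret \<mu>: finite_borel_measure \<mu> by fact
  interpret \<nu>: finite_borel_measure \<nu> by fact
  note sets_eq = \<mu>.M_is_borel \<nu>.M_is_borel
  define F where "F x = cdf \<nu> x - cdf \<mu> x" for x
  define \<kappa> where "\<kappa> = interval_measure F"
  have F_diff: "F y - F x = measure \<nu> {x<..y} - measure \<mu> {x<..y}" if "x \<le> y" for x y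
  proof (cases "x = y")
    case False
    then show ?thesis
      using that \<mu>.cdf_diff_eq[of x y] \<nu>.cdf_diff_eq[of x y] by (simp add: F_def)
  qed simp
  have le': "measure \<mu> {x<..y} \<le> measure \<nu> {x<..y}" for x y
    using le[of x y] by (cases "x \<le> y") (simp_all add: \<mu>.emeasure_eq_measure \<nu>.emeasure_eq_measure)
  have mono: "F x \<le> F y" if "x \<le> y" for x y
    using F_diff[OF that] le'[of x y] by simp
  have cont: "continuous (at_right a) F" for a
    unfolding F_def by (intro continuous_intros \<mu>.cdf_is_right_cont \<nu>.cdf_is_right_cont)
  have Ioc: "emeasure \<kappa> {x<..y} + emeasure \<mu> {x<..y} = emeasure \<nu> {x<..y}" for x y
  proof (cases "x \<le> y")
    case True
    have "emeasure \<kappa> {x<..y} = ennreal (F y - F x)"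
      unfolding \<kappa>_def by (rule emeasure_interval_measure_Ioc[OF True mono cont])
    then show ?thesis
      using le'[of x y]
      by (simp add: F_diff[OF True] \<mu>.emeasure_eq_measure \<nu>.emeasure_eq_measure flip: ennreal_plus)
  qed simp
  have sets_\<kappa>: "sets \<kappa> = sets borel" by (simp add: \<kappa>_def)
  have lim: "(\<lambda>n::nat. emeasure N {- real n<..real n}) \<longlonglongrightarrow> emeasure N UNIV"
    if "sets N = sets borel" for N :: "real measure"
    unfolding UN_Ioc_real_of_nat[symmetric] by (rule Lim_emeasure_incseq) (auto simp: incseq_def that)
  \<comment> \<open>The whole line is not a half-open interval, so the total masses are compared by
    exhaustion; the induction below needs them for complements.\<close>
  have "(\<lambda>n::nat. emeasure \<kappa> {- real n<..real n} + emeasure \<mu> {- real n<..real n})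
      \<longlonglongrightarrow> emeasure \<kappa> UNIV + emeasure \<mu> UNIV"
    by (intro tendsto_add lim sets_\<kappa> sets_eq)
  from LIMSEQ_unique[OF this, of "emeasure \<nu> UNIV"]
  have UNIV_eq: "emeasure \<kappa> UNIV + emeasure \<mu> UNIV = emeasure \<nu> UNIV"
    unfolding Ioc using lim[OF sets_eq(2)] by simp
  have fin: "emeasure \<kappa> UNIV \<noteq> \<infinity>"
    using UNIV_eq \<nu>.emeasure_finite[of UNIV] by (metis ennreal_add_eq_top infinity_ennreal_def)
  have eq: "emeasure \<kappa> E + emeasure \<mu> E = emeasure \<nu> E" if E: "E \<in> sets borel" for E
  proof -
    let ?G = "range (\<lambda>(a, b). {a <.. b::real})"
    have stable: "Int_stable ?G"
    proof (rule Int_stableI)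
      fix A B assume "A \<in> ?G" "B \<in> ?G"
      then obtain a b c d where "A = {a<..b}" "B = {c<..d}" by auto
      then have "A \<inter> B = {max a c<..min b d}" by auto
      then show "A \<inter> B \<in> ?G" by auto
    qed
    have "E \<in> sigma_sets UNIV ?G"
      using E unfolding borel_sigma_sets_Ioc by simp
    have closed: "?G \<subseteq> Pow UNIV" by auto
    from stable closed \<open>E \<in> sigma_sets UNIV ?G\<close> show ?thesis
    proof (induction rule: sigma_sets_induct_disjoint)
      case (basic A)
      then show ?case using Ioc by auto
    next
      case (compl A)
      then have A: "A \<in> sets borel" unfolding borel_sigma_sets_Ioc by simp
      have fA: "emeasure \<kappa> A \<noteq> \<infinity>"
        using emeasure_mono[of A UNIV \<kappa>] fin by (auto simp: sets_\<kappa> top_unique)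
      \<comment> \<open>Instead of subtracting in \<open>ennreal\<close>, the equation for
        \<open>A\<close> is added to the one for its complement; the finite term
        \<open>emeasure \<nu> A\<close> is then cancelled.\<close>
      have "(emeasure \<kappa> (UNIV - A) + emeasure \<mu> (UNIV - A)) + (emeasure \<kappa> A + emeasure \<mu> A)
          = emeasure \<nu> (UNIV - A) + emeasure \<nu> A"
      proof -
        have *: "emeasure N (UNIV - A) + emeasure N A = emeasure N UNIV"
          if "sets N = sets borel" for N :: "real measure"
          using A that by (subst plus_emeasure) auto
        show ?thesis
          using *[OF sets_\<kappa>] *[OF sets_eq(1)] *[OF sets_eq(2)] UNIV_eq
          by (metis (no_types, lifting) add.assoc add.left_commute)
      qed
      then have "emeasure \<nu> A + (emeasure \<kappa> (UNIV - A) + emeasure \<mu> (UNIV - A))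
          = emeasure \<nu> A + emeasure \<nu> (UNIV - A)"
        using compl by (simp add: add.commute)
      then show ?case
        by (simp add: \<nu>.emeasure_finite)
    next
      case (union A)
      then have A: "range A \<subseteq> sets borel" unfolding borel_sigma_sets_Ioc by auto
      have *: "(\<Sum>i. emeasure N (A i)) = emeasure N (\<Union>i. A i)"
        if "sets N = sets borel" for N :: "real measure"
        using A union.hyps that by (intro suminf_emeasure) auto
      have "(\<Sum>i. emeasure \<kappa> (A i)) + (\<Sum>i. emeasure \<mu> (A i)) = (\<Sum>i. emeasure \<nu> (A i))"
        using union by (subst suminf_add) auto
      then show ?case unfolding *[OF sets_\<kappa>] *[OF sets_eq(1)] *[OF sets_eq(2)] .
    qed simp_all
  qed
  have "emeasure \<mu> E \<le> emeasure \<nu> E" for E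
  proof (cases "E \<in> sets borel")
    case True
    have "emeasure \<mu> E \<le> emeasure \<kappa> E + emeasure \<mu> E" by simp
    then show ?thesis using eq[OF True] by simp
  next
    case False
    then show ?thesis using sets_eq by (simp add: emeasure_notin_sets)
  qed
  then show ?thesis
    by (simp add: le_measure sets_eq)
qed

text \<open>A Vitali covering argument. At an exceptional point of \<open>A\<close> arbitrarily
  small balls have mass above \<open>e * r\<close>. Disjoint balls of this kind inside an open set
  \<open>U\<close> of small mass cover almost all such points, and their total length is at most
  \<open>2 / e\<close> times the mass of \<open>U\<close>.\<close>

lemma AE_zero_density:
  fixes \<mu> :: "real measure"
  assumes fin: "finite_measure \<mu>" and sb: "sets \<mu> = sets borel"
    and A: "A \<in> sets borel" "emeasure \<mu> A = 0"
  shows "AE x in lebesgue. x \<in> A \<longrightarrow>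
    (\<forall>e>0. \<exists>\<delta>>0. \<forall>r. 0 < r \<and> r < \<delta> \<longrightarrow> measure \<mu> (ball x r) \<le> e * r)"
proof -
  interpret finite_measure \<mu> by fact
  define S where
    "S e = {x\<in>A. \<forall>\<delta>>0. \<exists>r. 0 < r \<and> r < \<delta> \<and> e * r < measure \<mu> (ball x r)}" for e :: real
  have neg: "negligible (S e)" if "0 < e" for e
    unfolding negligible_outer_le
  proof (intro allI impI)
    fix \<eta> :: real assume "0 < \<eta>"
    \<comment> \<open>Outer regularity. The bound \<open>e * \<eta> / 2\<close> offsets the factor
      \<open>2 / e\<close> that arises because a ball of radius \<open>r\<close> has length
      \<open>2 * r\<close> and mass above \<open>e * r\<close>.\<close>
    have "(INF U\<in>{U. A \<subseteq> U \<and> open U}. emeasure \<mu> U) = 0"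
      using A by (subst outer_regular[symmetric]) (auto simp: sb emeasure_eq_measure)
    then have "\<exists>U\<in>{U. A \<subseteq> U \<and> open U}. emeasure \<mu> U < ennreal (e * \<eta> / 2)"
      using \<open>0 < e\<close> \<open>0 < \<eta>\<close> by (subst INF_less_iff[symmetric]) simp
    then obtain U where U: "A \<subseteq> U" "open U" "emeasure \<mu> U < ennreal (e * \<eta> / 2)" by auto
    then have mU: "measure \<mu> U < e * \<eta> / 2"
      using \<open>0 < e\<close> \<open>0 < \<eta>\<close> by (simp add: emeasure_eq_measure ennreal_less_iff)
    let ?K = "{(x, r). x \<in> S e \<and> 0 < r \<and> ball x r \<subseteq> U \<and> e * r < measure \<mu> (ball x r)}"
    obtain C where C: "countable C" "C \<subseteq> ?K"
      "pairwise (\<lambda>i j. disjnt (ball (fst i) (snd i)) (ball (fst j) (snd j))) C"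
      "negligible (S e - (\<Union>i\<in>C. ball (fst i) (snd i)))"
    proof (rule Vitali_covering_theorem_balls[of "S e" ?K fst snd])
      fix x d :: real assume x: "x \<in> S e" and "0 < d"
      then obtain k where k: "0 < k" "ball x k \<subseteq> U"
        using U openE[OF U(2), of x] by (auto simp: S_def)
      then obtain r where "0 < r" "r < min d k" "e * r < measure \<mu> (ball x r)"
        using x \<open>0 < d\<close> unfolding S_def by (auto dest!: spec[of _ "min d k"])
      moreover have "ball x r \<subseteq> U"
        using k(2) \<open>r < min d k\<close> by (auto simp: subset_iff)
      ultimately show "\<exists>i. i \<in> ?K \<and> x \<in> ball (fst i) (snd i) \<and> snd i < d"
        using x by (intro exI[of _ "(x, r)"]) auto
    qed
    have fin_le: "measure lebesgue (\<Union>i\<in>J. ball (fst i) (snd i)) \<le> \<eta>" if J: "J \<subseteq> C" "finite J" for J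
    proof -
      have "measure lebesgue (\<Union>i\<in>J. ball (fst i) (snd i))
          \<le> (\<Sum>i\<in>J. measure lebesgue (ball (fst i) (snd i)))"
        using J by (intro measure_UNION_le) auto
      also have "\<dots> \<le> (\<Sum>i\<in>J. 2 / e * measure \<mu> (ball (fst i) (snd i)))"
      proof (rule sum_mono)
        fix i assume "i \<in> J"
        then have i: "0 < snd i" "e * snd i < measure \<mu> (ball (fst i) (snd i))"
          using J C(2) by auto
        have "measure lebesgue (ball (fst i) (snd i)) = 2 * snd i"
          using i(1) by (simp add: ball_eq_greaterThanLessThan)
        then show "measure lebesgue (ball (fst i) (snd i)) \<le> 2 / e * measure \<mu> (ball (fst i) (snd i))"
          using i \<open>0 < e\<close> by (simp add: field_simps)
      qed
      also have "\<dots> = 2 / e * measure \<mu> (\<Union>i\<in>J. ball (fst i) (snd i))"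
      proof -
        have "disjoint_family_on (\<lambda>i. ball (fst i) (snd i)) J"
          using J(1) C(3) unfolding disjoint_family_on_def pairwise_def disjnt_def by blast
        then show ?thesis
          using J(2) unfolding sum_distrib_left[symmetric]
          by (subst finite_measure_finite_Union) (auto simp: sb)
      qed
      also have "\<dots> \<le> 2 / e * measure \<mu> U"
        using J C(2) U(2) \<open>0 < e\<close>
        by (intro mult_left_mono finite_measure_mono) (fastforce simp: sb)+
      also have "\<dots> \<le> \<eta>" using mU \<open>0 < e\<close> by (simp add: field_simps)
      finally show ?thesis .
    qed
    let ?B = "\<Union>i\<in>C. ball (fst i) (snd i)"
    have B: "?B \<in> lmeasurable" "measure lebesgue ?B \<le> \<eta>"
      using fin_le \<open>0 < \<eta>\<close>
      by (auto intro!: fmeasurable_UN_bound[OF C(1)] measure_UN_bound[OF C(1)])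
    show "\<exists>T. S e \<subseteq> T \<and> T \<in> lmeasurable \<and> measure lebesgue T \<le> \<eta>"
    proof (intro exI[of _ "?B \<union> (S e - ?B)"] conjI)
      show "?B \<union> (S e - ?B) \<in> lmeasurable"
        using B(1) negligible_imp_measurable[OF C(4)] by (rule fmeasurable.Un)
      have "measure lebesgue (?B \<union> (S e - ?B)) \<le> measure lebesgue ?B + measure lebesgue (S e - ?B)"
        using B(1) C(4) negligible_imp_measurable[OF C(4)] by (intro measure_Un_le) auto
      then show "measure lebesgue (?B \<union> (S e - ?B)) \<le> \<eta>"
        using B(2) negligible_imp_measure0[OF C(4)] by simp
    qed auto
  qed
  have "negligible (\<Union>n. S (inverse (real (Suc n))))"
    by (intro negligible_countable_Union) (auto intro: neg)
  then have "(\<Union>n. S (inverse (real (Suc n)))) \<in> null_sets lebesgue"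
    by (simp add: negligible_iff_null_sets)
  then show ?thesis
  proof (rule AE_I', intro subsetI)
    fix x assume "x \<in> {x \<in> space lebesgue. \<not> (x \<in> A \<longrightarrow>
      (\<forall>e>0. \<exists>\<delta>>0. \<forall>r. 0 < r \<and> r < \<delta> \<longrightarrow> measure \<mu> (ball x r) \<le> e * r))}"
    then obtain e where x: "x \<in> A" and e: "0 < (e::real)"
      and no: "\<not> (\<exists>\<delta>>0. \<forall>r. 0 < r \<and> r < \<delta> \<longrightarrow> measure \<mu> (ball x r) \<le> e * r)" by auto
    obtain n where n: "inverse (real (Suc n)) < e" using reals_Archimedean[OF e] by auto
    have "\<exists>r. 0 < r \<and> r < \<delta> \<and> inverse (real (Suc n)) * r < measure \<mu> (ball x r)" if "0 < \<delta>" for \<delta>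
    proof -
      from no that obtain r where r: "0 < r" "r < \<delta>" "e * r < measure \<mu> (ball x r)"
        by (auto simp: not_le)
      moreover have "inverse (real (Suc n)) * r \<le> e * r"
        using n r by (intro mult_right_mono) auto
      ultimately show ?thesis
        by (meson le_less_trans)
    qed
    then have "x \<in> S (inverse (real (Suc n)))"
      using x unfolding S_def by blast
    then show "x \<in> (\<Union>n. S (inverse (real (Suc n))))" by blast
  qed
qed

section \<open>Lebesgue differentiation\<close>

text \<open>This is one half of Lebesgue's differentiation theorem. For rational \<open>q\<close>
  the measure with density \<open>max 0 (f - q)\<close> does not charge \<open>{f \<le> q}\<close>,
  hence has density zero at almost every point of that set. With \<open>q\<close> slightly above
  \<open>f x\<close>, averages of \<open>f\<close> near \<open>x\<close> exceed \<open>q\<close> by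
  little. The intervals need not be centred at \<open>x\<close>, which later yields both one-sided
  difference quotients.\<close>

lemma AE_average_le:
  fixes f :: "real \<Rightarrow> real"
  assumes f: "integrable lborel f"
  shows "AE x in lebesgue. \<forall>e>0. \<exists>\<delta>>0. \<forall>c d. c \<le> x \<and> x \<le> d \<and> c < d \<and> d - c < \<delta> \<longrightarrow>
    (LINT t:{c..d}|lborel. f t) \<le> (f x + e) * (d - c)"
proof -
  have [measurable]: "f \<in> borel_measurable borel"
    using borel_measurable_integrable[OF f] by simp
  \<comment> \<open>For \<open>q < 0\<close> the excess over \<open>q\<close> need not be integrable
    on the whole line; the cutoff to a bounded interval makes it so.\<close>
  define g where "g q n t = max 0 (f t - q) * indicator ({- real n<..<real n}) t" for q :: real and n :: nat and t
  have g_meas[measurable]: "g q n \<in> borel_measurable borel" for q n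
    unfolding g_def by measurable
  have g_nonneg: "0 \<le> g q n t" for q n t by (simp add: g_def)
  have g_int: "integrable lborel (g q n)" for q n
  proof (rule Bochner_Integration.integrable_bound)
    show "integrable lborel (\<lambda>t. \<bar>f t\<bar> + \<bar>q\<bar> * indicator ({- real n<..<real n}) t)"
      using f by (intro Bochner_Integration.integrable_add integrable_abs integrable_mult_right
          integrable_real_indicator) auto
    show "AE t in lborel. norm (g q n t) \<le> norm (\<bar>f t\<bar> + \<bar>q\<bar> * indicator ({- real n<..<real n}) t)"
      by (intro AE_I2) (auto simp: g_def indicator_def)
  qed auto
  define \<mu> where "\<mu> q n = density lborel (\<lambda>t. ennreal (g q n t))" for q n
  have sets_\<mu>: "sets (\<mu> q n) = sets borel" for q n by (simp add: \<mu>_def)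
  have \<mu>_eq: "emeasure (\<mu> q n) E = ennreal (LINT t:E|lborel. g q n t)" if "E \<in> sets borel" for q n E
  proof -
    have "emeasure (\<mu> q n) E = (\<integral>\<^sup>+t. ennreal (indicator E t *\<^sub>R g q n t) \<partial>lborel)"
      using that unfolding \<mu>_def
      by (subst emeasure_density) (auto intro!: nn_integral_cong split: split_indicator)
    also have "\<dots> = ennreal (LINT t:E|lborel. g q n t)"
      unfolding set_lebesgue_integral_def using that
      by (intro nn_integral_eq_integral integrable_mult_indicator g_int)
        (auto simp: g_nonneg)
    finally show ?thesis .
  qed
  have fin: "finite_measure (\<mu> q n)" for q n
    using \<mu>_eq[of UNIV q n] by (intro finite_measureI) (simp add: \<mu>_def)
  have g0: "emeasure (\<mu> q n) {x. f x \<le> q} = 0" for q n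
  proof -
    have "(LINT t:{x. f x \<le> q}|lborel. g q n t) = (LINT t::real|lborel. 0)"
      unfolding set_lebesgue_integral_def
      by (intro Bochner_Integration.integral_cong) (auto simp: g_def indicator_def)
    then show ?thesis by (subst \<mu>_eq) auto
  qed
  have "AE x in lebesgue. \<forall>n. f x \<le> q \<longrightarrow>
      (\<forall>e>0. \<exists>\<delta>>0. \<forall>r. 0 < r \<and> r < \<delta> \<longrightarrow> measure (\<mu> q n) (ball x r) \<le> e * r)" for q
    unfolding AE_all_countable using AE_zero_density[OF fin sets_\<mu> _ g0, of q] by simp
  then have "AE x in lebesgue. \<forall>q\<in>\<rat>. \<forall>n. f x \<le> q \<longrightarrow>
      (\<forall>e>0. \<exists>\<delta>>0. \<forall>r. 0 < r \<and> r < \<delta> \<longrightarrow> measure (\<mu> q n) (ball x r) \<le> e * r)"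
    unfolding AE_ball_countable[OF countable_rat] by blast
  then show ?thesis
  proof (rule AE_mp, intro AE_I2 impI allI)
    fix x e :: real
    assume x: "\<forall>q\<in>\<rat>. \<forall>n. f x \<le> q \<longrightarrow>
        (\<forall>e>0. \<exists>\<delta>>0. \<forall>r. 0 < r \<and> r < \<delta> \<longrightarrow> measure (\<mu> q n) (ball x r) \<le> e * r)" and "0 < e"
    obtain q where q: "q \<in> \<rat>" "f x < q" "q < f x + e / 2"
      using Rats_dense_in_real[of "f x" "f x + e / 2"] \<open>0 < e\<close> by auto
    obtain n :: nat where n: "\<bar>x\<bar> < real n" using reals_Archimedean2 by blast
    have "0 < e / 4" using \<open>0 < e\<close> by simp
    with x q obtain \<delta> where \<delta>: "0 < \<delta>"
      "\<And>r. 0 < r \<Longrightarrow> r < \<delta> \<Longrightarrow> measure (\<mu> q n) (ball x r) \<le> e / 4 * r"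
      by (metis less_imp_le)
    \<comment> \<open>The witness has two tasks: \<open>real n - \<bar>x\<bar>\<close> keeps
      \<open>{c..d}\<close> inside the cutoff, and \<open>\<delta> / 2\<close> admits the ball of
      radius \<open>2 * (d - c)\<close>, an open ball about \<open>x\<close> large enough to contain
      both end points.\<close>
    show "\<exists>\<delta>>0. \<forall>c d. c \<le> x \<and> x \<le> d \<and> c < d \<and> d - c < \<delta> \<longrightarrow>
        (LINT t:{c..d}|lborel. f t) \<le> (f x + e) * (d - c)"
    proof (intro exI[of _ "min (\<delta> / 2) (real n - \<bar>x\<bar>)"] conjI allI impI; (elim conjE)?)
      show "0 < min (\<delta> / 2) (real n - \<bar>x\<bar>)" using \<delta>(1) n by simp
    next
      fix c d assume cd: "c \<le> x" "x \<le> d" "c < d" "d - c < min (\<delta> / 2) (real n - \<bar>x\<bar>)"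
      have gsi: "set_integrable lborel S (g q n)" if "S \<in> sets borel" for S
        unfolding set_integrable_def using that by (intro integrable_mult_indicator g_int) auto
      have fsi: "set_integrable lborel {c..d} f"
        unfolding set_integrable_def by (intro integrable_mult_indicator f) auto
      have qsi: "set_integrable lborel {c..d} (\<lambda>_. q)"
        unfolding set_integrable_def using cd
        by (intro integrable_scaleR_left integrable_real_indicator) auto
      have "(LINT t:{c..d}|lborel. f t) \<le> (LINT t:{c..d}|lborel. q + g q n t)"
        using cd by (intro set_integral_mono fsi set_integral_add(1) qsi gsi)
          (auto simp: g_def indicator_def dist_real_def)
      also have "\<dots> = q * (d - c) + (LINT t:{c..d}|lborel. g q n t)"
      proof -
        have "(LINT t:{c..d}|lborel. q) = q * (d - c)"
          unfolding set_lebesgue_integral_def using cd by simp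
        then show ?thesis by (subst set_integral_add(2)[OF qsi gsi]) auto
      qed
      also have "(LINT t:{c..d}|lborel. g q n t) \<le> (LINT t:ball x (2 * (d - c))|lborel. g q n t)"
        unfolding set_lebesgue_integral_def using cd
        by (intro integral_mono integrable_mult_indicator g_int)
          (auto simp: g_nonneg indicator_def dist_real_def)
      also have "\<dots> = measure (\<mu> q n) (ball x (2 * (d - c)))"
      proof -
        have "0 \<le> (LINT t:ball x (2 * (d - c))|lborel. g q n t)"
          unfolding set_lebesgue_integral_def by (intro integral_nonneg_AE) (auto simp: g_nonneg)
        then show ?thesis by (simp add: measure_def \<mu>_eq)
      qed
      also have "\<dots> \<le> e / 4 * (2 * (d - c))"
        using cd by (intro \<delta>(2)) auto
      also have "q * (d - c) + e / 4 * (2 * (d - c)) = (q + e / 2) * (d - c)"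
        by (simp add: field_simps)
      also have "\<dots> \<le> (f x + e) * (d - c)"
        using q cd by (intro mult_right_mono) auto
      finally show "(LINT t:{c..d}|lborel. f t) \<le> (f x + e) * (d - c)" by simp
    qed
  qed
qed

text \<open>Applied to \<open>f\<close> and to \<open>- f\<close>, the one-sided estimate
  \<open>AE_average_le\<close> traps the difference quotient; \<open>c\<close> and \<open>d\<close>
  order the two points so that left and right increments are treated together.\<close>

lemma AE_has_real_derivative_indefinite_integral:
  fixes f F :: "real \<Rightarrow> real"
  assumes f: "integrable lborel f"
    and F: "\<And>x y. a \<le> x \<Longrightarrow> x \<le> y \<Longrightarrow> y \<le> b \<Longrightarrow> F y - F x = (LINT t:{x..y}|lborel. f t)"
  shows "AE x in lebesgue. x \<in> {a<..<b} \<longrightarrow> (F has_real_derivative f x) (at x)"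
  using AE_average_le[OF f] AE_average_le[OF integrable_minus[OF f]]
proof eventually_elim
  case (elim x)
  show ?case unfolding has_field_derivative_iff
  proof (intro impI tendstoI)
    assume x: "x \<in> {a<..<b}"
    fix e :: real assume "0 < e"
    then have e: "0 < e / 2" by simp
    obtain \<delta>1 where \<delta>1: "0 < \<delta>1" "\<And>c d. c \<le> x \<Longrightarrow> x \<le> d \<Longrightarrow> c < d \<Longrightarrow> d - c < \<delta>1 \<Longrightarrow>
        (LINT t:{c..d}|lborel. f t) \<le> (f x + e / 2) * (d - c)"
      using elim(1) e by (metis (no_types, lifting))
    obtain \<delta>2 where \<delta>2: "0 < \<delta>2" "\<And>c d. c \<le> x \<Longrightarrow> x \<le> d \<Longrightarrow> c < d \<Longrightarrow> d - c < \<delta>2 \<Longrightarrow>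
        (LINT t:{c..d}|lborel. - f t) \<le> (- f x + e / 2) * (d - c)"
      using elim(2) e by (metis (no_types, lifting))
    define \<delta> where "\<delta> = min (min \<delta>1 \<delta>2) (min (x - a) (b - x))"
    have "0 < \<delta>" using \<delta>1(1) \<delta>2(1) x by (simp add: \<delta>_def)
    have "dist ((F y - F x) / (y - x)) (f x) < e" if y: "y \<noteq> x" "dist y x < \<delta>" for y
    proof -
      define c d where "c = min x y" and "d = max x y"
      have cd: "c \<le> x" "x \<le> d" "c < d" "d - c < \<delta>" "a \<le> c" "d \<le> b"
        using y x by (auto simp: c_def d_def \<delta>_def dist_real_def)
      have eq: "(F y - F x) / (y - x) = (F d - F c) / (d - c)"
        using y(1) by (auto simp: c_def d_def min_def max_def field_simps)
      have Fdc: "F d - F c = (LINT t:{c..d}|lborel. f t)" using cd by (intro F) auto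
      have fsi: "set_integrable lborel {c..d} f"
        unfolding set_integrable_def by (intro integrable_mult_indicator f) auto
      have "F d - F c \<le> (f x + e / 2) * (d - c)"
        unfolding Fdc using cd by (intro \<delta>1(2)) (auto simp: \<delta>_def)
      moreover have "- (F d - F c) \<le> (- f x + e / 2) * (d - c)"
        unfolding Fdc set_integral_uminus[OF fsi, symmetric]
        using cd by (intro \<delta>2(2)) (auto simp: \<delta>_def)
      ultimately have "\<bar>(F d - F c) - f x * (d - c)\<bar> \<le> e / 2 * (d - c)"
        unfolding distrib_right abs_le_iff by simp
      then have "\<bar>(F d - F c) / (d - c) - f x\<bar> \<le> e / 2"
      proof -
        have "(F d - F c) / (d - c) - f x = ((F d - F c) - f x * (d - c)) / (d - c)"
          using cd(3) by (simp add: diff_divide_distrib)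
        then show ?thesis
          using \<open>\<bar>(F d - F c) - f x * (d - c)\<bar> \<le> e / 2 * (d - c)\<close> cd(3)
          by (simp add: abs_divide pos_divide_le_eq)
      qed
      then show ?thesis unfolding eq dist_real_def using \<open>0 < e\<close> by linarith
    qed
    then show "\<forall>\<^sub>F y in at x. dist ((F y - F x) / (y - x)) (f x) < e"
      unfolding eventually_at using \<open>0 < \<delta>\<close> by blast
  qed
qed

section \<open>Functions with increments dominated by an integral\<close>

lemma set_integral_Icc_combine:
  fixes f :: "real \<Rightarrow> real"
  assumes "integrable lborel f" "x \<le> y" "y \<le> z"
  shows "(LINT t:{x..z}|lborel. f t) = (LINT t:{x..y}|lborel. f t) + (LINT t:{y..z}|lborel. f t)"
proof -
  have si: "set_integrable lborel S f" if "S \<in> sets borel" for S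
    unfolding set_integrable_def using that by (intro integrable_mult_indicator assms) auto
  have "{x..z} = {x..y} \<union> {y<..z}" using assms by auto
  then have "(LINT t:{x..z}|lborel. f t) = (LINT t:{x..y}|lborel. f t) + (LINT t:{y<..z}|lborel. f t)"
    by (simp only:) (rule set_integral_Un, auto intro!: si)
  also have "(LINT t:{y<..z}|lborel. f t) = (LINT t:{y..z}|lborel. f t)"
    unfolding set_lebesgue_integral_def
    using borel_measurable_integrable[OF assms(1)]
    by (intro integral_cong_AE) (use AE_lborel_singleton[of y] in \<open>auto split: split_indicator\<close>)
  finally show ?thesis .
qed

text \<open>With \<open>H\<close> a primitive of \<open>h\<close>, the function
  \<open>W = U + H\<close> is nondecreasing and its Stieltjes measure is at most
  \<open>2 * h\<close> times Lebesgue measure, hence absolutely continuous. Subtracting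
  \<open>h\<close> from its Radon-Nikodym density \<open>k\<close> recovers
  \<open>U\<close>.\<close>

proposition increments_eq_integral:
  fixes U h :: "real \<Rightarrow> real"
  assumes h: "integrable lborel h" and h_nonneg: "\<And>x. 0 \<le> h x" and ab: "a \<le> b"
    and U: "\<And>x y. a \<le> x \<Longrightarrow> x \<le> y \<Longrightarrow> y \<le> b \<Longrightarrow> \<bar>U y - U x\<bar> \<le> (LINT t:{x..y}|lborel. h t)"
  obtains f :: "real \<Rightarrow> real" where "integrable lborel f"
    and "\<And>x y. a \<le> x \<Longrightarrow> x \<le> y \<Longrightarrow> y \<le> b \<Longrightarrow> U y - U x = (LINT t:{x..y}|lborel. f t)"
proof -
  have [measurable]: "h \<in> borel_measurable borel"
    using borel_measurable_integrable[OF h] by simp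
  have si: "set_integrable lborel S h" if "S \<in> sets borel" for S
    unfolding set_integrable_def using that by (intro integrable_mult_indicator h) auto
  \<comment> \<open>Clamping to \<open>{a..b}\<close> makes \<open>W\<close> a function on the whole
    line that is constant outside the interval, as the Stieltjes construction requires.\<close>
  define cl where "cl x = max a (min b x)" for x
  have cl: "a \<le> cl x" "cl x \<le> b" for x using ab by (auto simp: cl_def)
  have cl_mono: "cl x \<le> cl y" if "x \<le> y" for x y using that by (auto simp: cl_def)
  define H where "H x = (LINT t:{a..cl x}|lborel. h t)" for x
  define W where "W x = U (cl x) + H x" for x
  have H_diff: "H y - H x = (LINT t:{cl x..cl y}|lborel. h t)" if "x \<le> y" for x y
    unfolding H_def using set_integral_Icc_combine[OF h cl(1) cl_mono[OF that]] by simp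
  have U_diff: "\<bar>U (cl y) - U (cl x)\<bar> \<le> H y - H x" if "x \<le> y" for x y
    unfolding H_diff[OF that] using cl cl_mono[OF that] by (intro U)
  have W_mono: "W x \<le> W y" if "x \<le> y" for x y
    using U_diff[OF that] by (simp add: W_def abs_le_iff)
  \<comment> \<open>The factor 2: an increment of \<open>W\<close> is one of \<open>U\<close> plus
    one of \<open>H\<close>, each at most the integral of \<open>h\<close>.\<close>
  define \<mu> where "\<mu> = density lborel (\<lambda>t. ennreal (2 * h t))"
  have \<mu>_eq: "emeasure \<mu> E = ennreal (2 * (LINT t:E|lborel. h t))" if "E \<in> sets borel" for E
  proof -
    have "emeasure \<mu> E = (\<integral>\<^sup>+t. ennreal (2 * (indicator E t *\<^sub>R h t)) \<partial>lborel)"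
      using that unfolding \<mu>_def
      by (subst emeasure_density) (auto intro!: nn_integral_cong split: split_indicator)
    also have "\<dots> = ennreal (LINT t|lborel. 2 * (indicator E t *\<^sub>R h t))"
      using that si[OF that] unfolding set_integrable_def
      by (intro nn_integral_eq_integral integrable_mult_right) (auto simp: h_nonneg)
    finally show ?thesis by (simp add: set_lebesgue_integral_def)
  qed
  have "finite_measure \<mu>"
    using \<mu>_eq[of UNIV] by (intro finite_measureI) (simp add: \<mu>_def)
  then have fb_\<mu>: "finite_borel_measure \<mu>"
    by (intro finite_borel_measure.intro finite_borel_measure_axioms.intro) (simp_all add: \<mu>_def)
  then interpret \<mu>: finite_borel_measure \<mu> .
  have W_le: "ennreal (W y - W x) \<le> emeasure \<mu> {x<..y}" if "x \<le> y" for x y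
  proof -
    have "W y - W x \<le> 2 * (H y - H x)"
      using U_diff[OF that] by (simp add: W_def abs_le_iff)
    also have "H y - H x = (LINT t:{cl x<..cl y}|lborel. h t)"
      unfolding H_diff[OF that] set_lebesgue_integral_def
      by (intro integral_cong_AE) (use AE_lborel_singleton[of "cl x"] in \<open>auto split: split_indicator\<close>)
    also have "\<dots> \<le> (LINT t:{x<..y}|lborel. h t)"
      unfolding set_lebesgue_integral_def using that h_nonneg
      by (intro integral_mono integrable_mult_indicator h)
        (auto simp: cl_def split: split_indicator)
    finally show ?thesis by (subst \<mu>_eq) (auto intro!: ennreal_leI)
  qed
  have W_cdf: "W y - W x \<le> cdf \<mu> y - cdf \<mu> x" if "x \<le> y" for x y
  proof (cases "x = y")
    case False
    then show ?thesis
      using W_le[OF that] \<mu>.cdf_diff_eq[of x y] that by (simp add: \<mu>.emeasure_eq_measure)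
  qed simp
  \<comment> \<open>\<open>W\<close> inherits right continuity from the distribution function of
    \<open>\<mu>\<close>, which dominates its increments.\<close>
  have W_cont: "continuous (at_right x) W" for x
    unfolding continuous_within
  proof (rule tendsto_sandwich[of "\<lambda>_. W x" _ _ "\<lambda>y. W x + (cdf \<mu> y - cdf \<mu> x)"])
    show "\<forall>\<^sub>F y in at_right x. W x \<le> W y" "\<forall>\<^sub>F y in at_right x. W y \<le> W x + (cdf \<mu> y - cdf \<mu> x)"
      using W_mono[of x] W_cdf[of x] by (auto simp: eventually_at_filter algebra_simps)
    have "(cdf \<mu> \<longlongrightarrow> cdf \<mu> x) (at_right x)"
      using \<mu>.cdf_is_right_cont[of x] by (simp add: continuous_within)
    from tendsto_add[OF tendsto_const tendsto_diff[OF this tendsto_const], of "W x" "cdf \<mu> x"]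
    show "((\<lambda>y. W x + (cdf \<mu> y - cdf \<mu> x)) \<longlongrightarrow> W x) (at_right x)" by simp
  qed auto
  define \<nu> where "\<nu> = interval_measure W"
  have \<nu>_Ioc: "emeasure \<nu> {x<..y} = ennreal (W y - W x)" if "x \<le> y" for x y
    unfolding \<nu>_def by (rule emeasure_interval_measure_Ioc[OF that W_mono W_cont])
  have "emeasure \<nu> UNIV \<le> emeasure \<mu> UNIV"
  proof (rule LIMSEQ_le_const2)
    have "(\<lambda>n::nat. emeasure \<nu> {- real n<..real n}) \<longlonglongrightarrow> emeasure \<nu> (\<Union>n::nat. {- real n<..real n})"
      by (rule Lim_emeasure_incseq) (auto simp: incseq_def \<nu>_def)
    then show "(\<lambda>n::nat. emeasure \<nu> {- real n<..real n}) \<longlonglongrightarrow> emeasure \<nu> UNIV"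
      by (simp only: UN_Ioc_real_of_nat)
    show "\<exists>N. \<forall>n\<ge>N. emeasure \<nu> {- real n<..real n} \<le> emeasure \<mu> UNIV"
    proof (intro exI allI impI)
      fix n :: nat
      have "emeasure \<nu> {- real n<..real n} \<le> emeasure \<mu> {- real n<..real n}"
        by (subst \<nu>_Ioc) (simp_all add: W_le)
      also have "\<dots> \<le> emeasure \<mu> UNIV" by (rule emeasure_mono) (simp_all add: \<mu>_def)
      finally show "emeasure \<nu> {- real n<..real n} \<le> emeasure \<mu> UNIV" .
    qed
  qed
  then have "finite_measure \<nu>"
    using \<mu>.emeasure_finite[of UNIV] by (intro finite_measureI) (auto simp: \<nu>_def top_unique)
  then have fb_\<nu>: "finite_borel_measure \<nu>"
    by (intro finite_borel_measure.intro finite_borel_measure_axioms.intro) (simp_all add: \<nu>_def)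
  have "\<nu> \<le> \<mu>"
    using fb_\<nu> fb_\<mu> by (rule emeasure_le_if_le_on_Ioc) (simp add: \<nu>_Ioc W_le)
  then have le: "emeasure \<nu> E \<le> emeasure \<mu> E" for E
    using le_measureD3[of \<nu> \<mu> E] by (simp add: \<nu>_def \<mu>_def)
  have sets_\<nu>: "sets \<nu> = sets lborel" by (simp add: \<nu>_def)
  have ac: "absolutely_continuous lborel \<nu>"
    unfolding absolutely_continuous_def
  proof
    fix N :: "real set" assume N: "N \<in> null_sets lborel"
    then have "N \<in> null_sets \<mu>"
      using absolutely_continuousI_density[of "\<lambda>t. ennreal (2 * h t)" lborel]
      by (auto simp: absolutely_continuous_def \<mu>_def)
    then show "N \<in> null_sets \<nu>"
      using le[of N] N by (auto simp: null_sets_def \<nu>_def)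
  qed
  obtain k where k: "k \<in> borel_measurable lborel" "AE x in lborel. RN_deriv lborel \<nu> x = ennreal (k x)"
    "AE x in \<nu>. 0 < k x" "\<And>x. 0 \<le> k x"
    by (rule sigma_finite_measure.real_RN_deriv[OF sigma_finite_lborel \<open>finite_measure \<nu>\<close> ac sets_\<nu>]) blast
  have "\<nu> = density lborel (RN_deriv lborel \<nu>)"
    using sigma_finite_measure.density_RN_deriv[OF sigma_finite_lborel ac sets_\<nu>] by simp
  also have "\<dots> = density lborel (\<lambda>x. ennreal (k x))"
    using k(1,2) by (intro density_cong) auto
  finally have \<nu>_k: "\<nu> = density lborel (\<lambda>x. ennreal (k x))" .
  have k_int: "integrable lborel k"
  proof (rule integrableI_nonneg)
    have "(\<integral>\<^sup>+x. ennreal (k x) \<partial>lborel) = emeasure \<nu> UNIV"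
      using k(1) unfolding \<nu>_k by (subst emeasure_density) auto
    then show "(\<integral>\<^sup>+x. ennreal (k x) \<partial>lborel) < \<infinity>"
      using finite_measure.emeasure_finite[OF \<open>finite_measure \<nu>\<close>, of UNIV] by (simp add: top.not_eq_extremum)
  qed (use k in auto)
  show ?thesis
  proof (rule that[of "\<lambda>t. k t - h t"])
    show "integrable lborel (\<lambda>t. k t - h t)" by (intro Bochner_Integration.integrable_diff k_int h)
    fix x y assume xy: "a \<le> x" "x \<le> y" "y \<le> b"
    then have clxy: "cl x = x" "cl y = y" by (auto simp: cl_def)
    have kx: "set_integrable lborel {x..y} k"
      unfolding set_integrable_def by (intro integrable_mult_indicator k_int) auto
    have ae: "AE t in lborel. ennreal (k t) * indicator {x<..y} t = ennreal (indicator {x..y} t *\<^sub>R k t)"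
      using AE_lborel_singleton[of x] by eventually_elim (auto split: split_indicator)
    have "ennreal (W y - W x) = emeasure \<nu> {x<..y}" by (simp add: \<nu>_Ioc[OF xy(2)])
    also have "\<dots> = (\<integral>\<^sup>+t. ennreal (k t) * indicator {x<..y} t \<partial>lborel)"
      unfolding \<nu>_k using k(1) by (subst emeasure_density) auto
    also have "\<dots> = (\<integral>\<^sup>+t. ennreal (indicator {x..y} t *\<^sub>R k t) \<partial>lborel)"
      using ae by (rule nn_integral_cong_AE)
    also have "\<dots> = ennreal (LINT t:{x..y}|lborel. k t)"
      unfolding set_lebesgue_integral_def
      using kx k(4) by (intro nn_integral_eq_integral) (auto simp: set_integrable_def)
    finally have "W y - W x = (LINT t:{x..y}|lborel. k t)"
      using W_mono[OF xy(2)] k(4)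
      by (subst (asm) ennreal_inj) (auto simp: set_lebesgue_integral_def intro!: integral_nonneg_AE)
    moreover have "W y - W x = U y - U x + (LINT t:{x..y}|lborel. h t)"
      using H_diff[OF xy(2)] by (simp add: W_def clxy)
    ultimately show "U y - U x = (LINT t:{x..y}|lborel. k t - h t)"
      using set_integral_diff(2)[OF kx si[of "{x..y}"]] by simp
  qed
qed

text \<open>Truncation: the part of \<open>h\<close> above a large \<open>n\<close> has small
  integral by dominated convergence, and the rest contributes at most \<open>n\<close> times the
  measure of \<open>E\<close>.\<close>

lemma set_integral_less_if_emeasure_less:
  fixes h :: "'a \<Rightarrow> real"
  assumes h: "integrable M h" "\<And>x. 0 \<le> h x" and "0 < e"
  obtains \<delta> where "0 < \<delta>"
    "\<And>E. E \<in> sets M \<Longrightarrow> emeasure M E < ennreal \<delta> \<Longrightarrow> (LINT t:E|M. h t) < e"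
proof -
  have [measurable]: "h \<in> borel_measurable M" using h(1) by auto
  have "(\<lambda>n. LINT t|M. h t - min (h t) (real n)) \<longlonglongrightarrow> (LINT t|M. 0)"
  proof (rule integral_dominated_convergence[where w = h])
    show "AE t in M. (\<lambda>n. h t - min (h t) (real n)) \<longlonglongrightarrow> 0"
    proof (intro AE_I2 tendsto_eventually)
      fix t
      obtain N :: nat where "h t \<le> real N" using real_arch_simple by blast
      then show "\<forall>\<^sub>F n in sequentially. h t - min (h t) (real n) = 0"
        by (intro eventually_sequentiallyI[of N]) auto
    qed
  qed (use h in auto)
  then have "\<forall>\<^sub>F n in sequentially. (LINT t|M. h t - min (h t) (real n)) < e / 2"
    using \<open>0 < e\<close> by (intro order_tendstoD(2)[where y = 0]) auto
  then obtain n where n: "(LINT t|M. h t - min (h t) (real n)) < e / 2"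
    by (auto simp: eventually_sequentially)
  have int: "integrable M (\<lambda>t. h t - min (h t) (real n))"
    by (rule Bochner_Integration.integrable_bound[OF h(1)]) (auto simp: h(2))
  show ?thesis
  proof (rule that[of "e / (2 * (real n + 1))"])
    \<comment> \<open>One half of \<open>e\<close> pays for the part above \<open>n\<close>, the
      other for the bounded part; \<open>n + 1\<close> avoids a division by zero.\<close>
    show "0 < e / (2 * (real n + 1))" using \<open>0 < e\<close> by simp
    fix E assume E: "E \<in> sets M" "emeasure M E < ennreal (e / (2 * (real n + 1)))"
    then have fin: "emeasure M E < \<infinity>" by (metis ennreal_less_top infinity_ennreal_def order_less_trans)
    have mE: "measure M E < e / (2 * (real n + 1))"
      using E(2) fin by (simp add: emeasure_eq_ennreal_measure ennreal_less_iff)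
    have "(LINT t:E|M. h t) \<le> (LINT t|M. (h t - min (h t) (real n)) + real n * indicator E t)"
      unfolding set_lebesgue_integral_def
      using E fin h by (intro integral_mono integrable_mult_indicator Bochner_Integration.integrable_add int
          integrable_mult_right integrable_real_indicator) (auto split: split_indicator)
    also have "\<dots> = (LINT t|M. h t - min (h t) (real n)) + real n * measure M E"
      using E fin by (subst Bochner_Integration.integral_add) (auto intro!: int)
    also have "\<dots> < e / 2 + real n * (e / (2 * (real n + 1)))"
      using n mE by (intro add_less_le_mono mult_left_mono) auto
    also have "\<dots> \<le> e" using \<open>0 < e\<close> by (simp add: field_simps)
    finally show "(LINT t:E|M. h t) < e" .
  qed
qed

section \<open>Curves in the real line\<close>

text \<open>The increments over disjoint intervals add up to at most the integral of
  \<open>h\<close> over their union, which is small when the total length is.\<close>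

lemma abs_continuous_on_if_increments_le:
  fixes U h :: "real \<Rightarrow> real"
  assumes h: "integrable lborel h" "\<And>x. 0 \<le> h x"
    and U: "\<And>x y. a \<le> x \<Longrightarrow> x \<le> y \<Longrightarrow> y \<le> b \<Longrightarrow> \<bar>U y - U x\<bar> \<le> (LINT t:{x..y}|lborel. h t)"
  shows "abs_continuous_on a b U"
  unfolding abs_continuous_on_def
proof (intro allI impI)
  fix e :: real assume "0 < e"
  obtain \<delta> where \<delta>: "0 < \<delta>"
    "\<And>E. E \<in> sets lborel \<Longrightarrow> emeasure lborel E < ennreal \<delta> \<Longrightarrow> (LINT t:E|lborel. h t) < e"
    using set_integral_less_if_emeasure_less[OF h \<open>0 < e\<close>] by metis
  have [measurable]: "h \<in> borel_measurable borel"
    using borel_measurable_integrable[OF h(1)] by simp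
  have "(\<Sum>i<n. \<bar>U (t i) - U (s i)\<bar>) < e"
    if st: "\<forall>i<n. a \<le> s i \<and> s i \<le> t i \<and> t i \<le> b" and
      disj: "disjoint_family_on (\<lambda>i. {s i<..<t i}) {..<n}" and
      small: "(\<Sum>i<n. t i - s i) < \<delta>" for n :: nat and s t
  proof -
    let ?E = "\<Union>i<n. {s i<..<t i}"
    have "(\<Sum>i<n. \<bar>U (t i) - U (s i)\<bar>) \<le> (\<Sum>i<n. LINT r:{s i..t i}|lborel. h r)"
      using st by (intro sum_mono U) auto
    \<comment> \<open>Only the open intervals are disjoint, the closed ones may share end points.
      These form a null set.\<close>
    also have "\<dots> = (\<Sum>i<n. LINT r:{s i<..<t i}|lborel. h r)"
    proof (rule sum.cong)
      fix i assume "i \<in> {..<n}"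
      have "AE r in lborel. indicat_real {s i..t i} r *\<^sub>R h r = indicat_real {s i<..<t i} r *\<^sub>R h r"
        using AE_lborel_singleton[of "s i"] AE_lborel_singleton[of "t i"]
        by eventually_elim (auto split: split_indicator)
      then show "(LINT r:{s i..t i}|lborel. h r) = (LINT r:{s i<..<t i}|lborel. h r)"
        unfolding set_lebesgue_integral_def by (intro integral_cong_AE) auto
    qed simp
    also have "\<dots> = (LINT r:?E|lborel. h r)"
      using disj h(1)
      by (intro set_integral_finite_Union[symmetric])
        (auto simp: set_integrable_def simp del: real_scaleR_def intro!: integrable_mult_indicator)
    also have "\<dots> < e"
    proof (rule \<delta>(2))
      have "emeasure lborel ?E \<le> (\<Sum>i<n. emeasure lborel {s i<..<t i})"
        by (rule emeasure_subadditive_finite) auto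
      also have "\<dots> = (\<Sum>i<n. ennreal (t i - s i))"
        using st by (intro sum.cong) auto
      also have "\<dots> = ennreal (\<Sum>i<n. t i - s i)"
        using st by (intro sum_ennreal) auto
      also have "\<dots> < ennreal \<delta>"
        using \<delta>(1) small by (rule ennreal_lessI)
      finally show "emeasure lborel ?E < ennreal \<delta>" .
    qed auto
    finally show ?thesis .
  qed
  then show "\<exists>\<delta>>0. \<forall>(n::nat) s t. (\<forall>i<n. a \<le> s i \<and> s i \<le> t i \<and> t i \<le> b) \<and>
      disjoint_family_on (\<lambda>i. {s i<..<t i}) {..<n} \<and> (\<Sum>i<n. t i - s i) < \<delta> \<longrightarrow>
      (\<Sum>i<n. \<bar>U (t i) - U (s i)\<bar>) < e"
    using \<delta>(1) by blast
qed

lemma dist_le_curve_length: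
  assumes "s \<le> t"
  shows "ennreal (dist (\<gamma> s) (\<gamma> t)) \<le> curve_length \<gamma> s t"
proof -
  let ?t = "\<lambda>i::nat. if i = 0 then s else t"
  have mem: "(1, ?t) \<in> {(n::nat, r). mono_on {..n} r \<and> r ` {..n} \<subseteq> {s..t}}"
    using assms by (auto simp: monotone_on_def)
  show ?thesis
    unfolding curve_length_def by (rule SUP_upper2[OF mem]) simp
qed

lemma arc_length_curve_lipschitz:
  assumes "arc_length_curve Y \<gamma> l" "s \<in> {0..l}" "t \<in> {0..l}"
  shows "dist (\<gamma> s) (\<gamma> t) \<le> \<bar>s - t\<bar>"
proof -
  have *: "dist (\<gamma> x) (\<gamma> y) \<le> y - x" if "0 \<le> x" "x \<le> y" "y \<le> l" for x y
    using dist_le_curve_length[OF that(2), of \<gamma>] assms(1) that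
    unfolding arc_length_curve_def by simp
  show ?thesis
    using *[of s t] *[of t s] assms(2,3) by (cases "s \<le> t") (auto simp: dist_commute)
qed

text \<open>Segments are the test curves: along them the upper gradient inequality bounds increments
  of \<open>u\<close> by integrals over intervals.\<close>

lemma arc_length_curve_segment:
  fixes x y :: real
  assumes "x < y" "{x..y} \<subseteq> Y"
  shows "arc_length_curve Y (\<lambda>s. x + s) (y - x)"
proof -
  have "curve_length (\<lambda>s. x + s) s t = ennreal (t - s)" if "s \<le> t" for s t
  proof (rule antisym)
    show "curve_length (\<lambda>s. x + s) s t \<le> ennreal (t - s)"
      unfolding curve_length_def
    proof (rule SUP_least, clarify)
      fix n :: nat and r :: "nat \<Rightarrow> real"
      assume r: "mono_on {..n} r" "r ` {..n} \<subseteq> {s..t}"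
      have "(\<Sum>i<n. ennreal (dist (x + r i) (x + r (Suc i)))) = (\<Sum>i<n. ennreal (r (Suc i) - r i))"
        using r(1) by (intro sum.cong) (auto simp: dist_real_def monotone_on_def)
      also have "\<dots> = ennreal (\<Sum>i<n. r (Suc i) - r i)"
        using r(1) by (intro sum_ennreal) (auto simp: monotone_on_def)
      also have "(\<Sum>i<n. r (Suc i) - r i) = r n - r 0"
        by (rule sum_lessThan_telescope)
      also have "ennreal (r n - r 0) \<le> ennreal (t - s)"
        using r(2) by (intro ennreal_leI) (auto simp: image_subset_iff intro!: diff_mono)
      finally show "(\<Sum>i<n. ennreal (dist (x + r i) (x + r (Suc i)))) \<le> ennreal (t - s)" .
    qed
    show "ennreal (t - s) \<le> curve_length (\<lambda>s. x + s) s t"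
      using dist_le_curve_length[OF that, of "\<lambda>s. x + s"] that by (simp add: dist_real_def)
  qed
  then show ?thesis
    using assms unfolding arc_length_curve_def
    by (auto intro!: continuous_intros)
qed

lemma line_integral_segment:
  assumes g: "g \<in> borel_measurable (lebesgue_on {x..y})"
  shows "line_integral g (\<lambda>s. x + s) (y - x) = (\<integral>\<^sup>+t. g t \<partial>lebesgue_on {x..y})"
proof -
  define f where "f t = g t * indicator {x..y} t" for t
  have f: "f \<in> borel_measurable lebesgue"
    using g unfolding f_def by (subst (asm) borel_measurable_restrict_space_iff_ennreal) auto
  have "(\<integral>\<^sup>+t. g t \<partial>lebesgue_on {x..y}) = (\<integral>\<^sup>+t. f t \<partial>lebesgue)"
    unfolding f_def by (subst nn_integral_restrict_space) auto
  also have "\<dots> = (\<integral>\<^sup>+t. f (x + 1 * t) \<partial>lebesgue)"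
    by (subst nn_integral_real_affine_lebesgue[OF f, of 1 x]) auto
  also have "\<dots> = (\<integral>\<^sup>+t. g (x + t) * indicator {0..y - x} t \<partial>lebesgue)"
    unfolding f_def by (intro nn_integral_cong) (auto split: split_indicator)
  also have "\<dots> = line_integral g (\<lambda>s. x + s) (y - x)"
    unfolding line_integral_def by (subst nn_integral_restrict_space) auto
  finally show ?thesis by simp
qed

text \<open>Take \<open>s\<close> as the last time at which the curve is at or below
  \<open>c\<close>, and \<open>t\<close> as the first later time at which it is at or above
  \<open>d\<close>. In between it stays strictly inside, and the Lipschitz bound forces the crossing
  to last at least \<open>d - c\<close>.\<close>

lemma lipschitz_crossing:
  fixes \<gamma> :: "real \<Rightarrow> real"
  assumes lip: "\<And>s t. s \<in> {0..l} \<Longrightarrow> t \<in> {0..l} \<Longrightarrow> dist (\<gamma> s) (\<gamma> t) \<le> \<bar>s - t\<bar>"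
    and cont: "continuous_on {0..l} \<gamma>" and "0 \<le> l" and cd: "\<gamma> 0 \<le> c" "c < d" "d \<le> \<gamma> l"
  obtains s t where "0 \<le> s" "t \<le> l" "d - c \<le> t - s"
    "\<And>r. s < r \<Longrightarrow> r < t \<Longrightarrow> c < \<gamma> r \<and> \<gamma> r < d"
proof -
  let ?A = "{r \<in> {0..l}. \<gamma> r \<le> c}"
  have "closed ?A"
    by (intro continuous_on_closed_Collect_le cont continuous_on_const) simp
  then have "compact ?A"
    by (rule back_subst[of compact, OF compact_Int_closed[OF compact_Icc[of 0 l]]]) auto
  moreover have "0 \<in> ?A" using \<open>0 \<le> l\<close> cd by simp
  ultimately obtain s where s: "s \<in> ?A" "\<And>r. r \<in> ?A \<Longrightarrow> r \<le> s"
    using compact_attains_sup[of ?A] by blast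
  let ?B = "{r \<in> {s..l}. d \<le> \<gamma> r}"
  have "closed ?B"
    using s(1) by (intro continuous_on_closed_Collect_le continuous_on_subset[OF cont] continuous_on_const) auto
  then have "compact ?B"
    by (rule back_subst[of compact, OF compact_Int_closed[OF compact_Icc[of s l]]]) auto
  moreover have "l \<in> ?B" using s cd by simp
  ultimately obtain t where t: "t \<in> ?B" "\<And>r. r \<in> ?B \<Longrightarrow> t \<le> r"
    using compact_attains_inf[of ?B] by blast
  show ?thesis
  proof (rule that[of s t])
    show "0 \<le> s" "t \<le> l" using s t by auto
    have "d - c \<le> dist (\<gamma> s) (\<gamma> t)" using s(1) t(1) by (auto simp: dist_real_def)
    also have "\<dots> \<le> t - s" using lip[of s t] s(1) t(1) by auto
    finally show "d - c \<le> t - s" .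
    fix r assume r: "s < r" "r < t"
    then show "c < \<gamma> r \<and> \<gamma> r < d"
      using s(1) s(2)[of r] t(1) t(2)[of r] by (auto simp: not_le[symmetric])
  qed
qed

text \<open>The push-forward of Lebesgue measure along a 1-Lipschitz curve dominates Lebesgue measure
  between the end points, since the curve has to cross every interval in between.\<close>

lemma nn_integral_le_line_integral:
  fixes \<gamma> :: "real \<Rightarrow> real"
  assumes lip: "\<And>s t. s \<in> {0..l} \<Longrightarrow> t \<in> {0..l} \<Longrightarrow> dist (\<gamma> s) (\<gamma> t) \<le> \<bar>s - t\<bar>"
    and cont: "continuous_on {0..l} \<gamma>" and "0 \<le> l"
    and g[measurable]: "g \<in> borel_measurable borel"
  shows "(\<integral>\<^sup>+x\<in>{min (\<gamma> 0) (\<gamma> l)..max (\<gamma> 0) (\<gamma> l)}. g x \<partial>lborel) \<le> line_integral g \<gamma> l"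
proof -
  define a b where "a = min (\<gamma> 0) (\<gamma> l)" and "b = max (\<gamma> 0) (\<gamma> l)"
  define \<mu> where "\<mu> = density lborel (indicator {a..b} :: real \<Rightarrow> ennreal)"
  define \<nu> where "\<nu> = distr (restrict_space lborel {0..l}) borel \<gamma>"
  have \<mu>_eq: "emeasure \<mu> E = emeasure lborel (E \<inter> {a..b})" if "E \<in> sets borel" for E
    using that unfolding \<mu>_def by (subst emeasure_density) (auto simp: nn_integral_indicator[symmetric]
        indicator_inter_arith mult.commute simp del: nn_integral_indicator)
  have \<gamma>_meas: "\<gamma> \<in> borel_measurable (restrict_space lborel {0..l})"
    using borel_measurable_continuous_on_restrict[OF cont]
    by (subst measurable_cong_sets[OF sets_restrict_space_cong[of lborel borel] refl]) simp_all
  have \<nu>_eq: "emeasure \<nu> E = emeasure lborel (\<gamma> -` E \<inter> {0..l})" if "E \<in> sets borel" for E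
    unfolding \<nu>_def using that \<gamma>_meas
    by (subst emeasure_distr) (auto simp: space_restrict_space emeasure_restrict_space)
  have crossing: "\<exists>s t. 0 \<le> s \<and> t \<le> l \<and> d - c \<le> t - s \<and> (\<forall>r. s < r \<and> r < t \<longrightarrow> c < \<gamma> r \<and> \<gamma> r < d)"
    if "a \<le> c" "c < d" "d \<le> b" for c d
  proof (cases "\<gamma> 0 \<le> \<gamma> l")
    case True
    then have "\<gamma> 0 \<le> c" "d \<le> \<gamma> l" using that by (auto simp: a_def b_def)
    then obtain s t where "0 \<le> s" "t \<le> l" "d - c \<le> t - s"
      "\<And>r. s < r \<Longrightarrow> r < t \<Longrightarrow> c < \<gamma> r \<and> \<gamma> r < d"
      using lipschitz_crossing[OF lip cont \<open>0 \<le> l\<close> _ \<open>c < d\<close>] by blast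
    then show ?thesis by blast
  next
    case False
    \<comment> \<open>A descending curve is reflected: its negative ascends across the interval from
      \<open>- d\<close> to \<open>- c\<close>.\<close>
    have "\<gamma>' 0 \<le> - d" "- d < - c" "- c \<le> \<gamma>' l" if "\<gamma>' = (\<lambda>s. - \<gamma> s)" for \<gamma>'
      using False \<open>a \<le> c\<close> \<open>c < d\<close> \<open>d \<le> b\<close> that by (auto simp: a_def b_def)
    note this[OF refl]
    from lipschitz_crossing[of l "\<lambda>s. - \<gamma> s", OF _ _ \<open>0 \<le> l\<close> this] lip cont
    obtain s t where "0 \<le> s" "t \<le> l" "- c - (- d) \<le> t - s"
      "\<And>r. s < r \<Longrightarrow> r < t \<Longrightarrow> - d < - \<gamma> r \<and> - \<gamma> r < - c"
      by (auto simp: dist_minus continuous_on_minus)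
    then show ?thesis by (intro exI[of _ s] exI[of _ t]) auto
  qed
  have "\<mu> \<le> \<nu>"
  proof (rule emeasure_le_if_le_on_Ioc)
    show "finite_borel_measure \<mu>"
    proof (intro finite_borel_measure.intro finite_borel_measure_axioms.intro finite_measureI)
      show "emeasure \<mu> (space \<mu>) \<noteq> \<infinity>"
        using \<mu>_eq[of UNIV] by (simp add: \<mu>_def emeasure_lborel_Icc_eq)
    qed (simp add: \<mu>_def)
    show "finite_borel_measure \<nu>"
    proof (intro finite_borel_measure.intro finite_borel_measure_axioms.intro finite_measureI)
      show "emeasure \<nu> (space \<nu>) \<noteq> \<infinity>"
        using \<nu>_eq[of UNIV] by (simp add: \<nu>_def emeasure_lborel_Icc_eq)
    qed (simp add: \<nu>_def)
    fix c d :: real assume "c \<le> d"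
    \<comment> \<open>Only the part of \<open>{c<..d}\<close> between the end points of the curve
      has to be crossed and is charged by \<open>\<mu>\<close>.\<close>
    define c' d' where "c' = max a c" and "d' = min b d"
    have "emeasure \<mu> {c<..d} \<le> emeasure lborel {c'..d'}"
      by (subst \<mu>_eq) (auto intro!: emeasure_mono simp: c'_def d'_def)
    also have "\<dots> \<le> emeasure \<nu> {c<..d}"
    proof (cases "c' < d'")
      case True
      then obtain s t where st: "0 \<le> s" "t \<le> l" "d' - c' \<le> t - s"
        "\<And>r. s < r \<Longrightarrow> r < t \<Longrightarrow> c' < \<gamma> r \<and> \<gamma> r < d'"
        using crossing[of c' d'] by (auto simp: c'_def d'_def)
      have "emeasure lborel {c'..d'} = ennreal (d' - c')" using True by simp
      also have "\<dots> \<le> ennreal (t - s)" using st(3) by (rule ennreal_leI)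
      also have "\<dots> = emeasure lborel {s<..<t}" using st(3) True by simp
      also have "\<dots> \<le> emeasure lborel (\<gamma> -` {c<..d} \<inter> {0..l})"
      proof (rule emeasure_mono)
        show "{s<..<t} \<subseteq> \<gamma> -` {c<..d} \<inter> {0..l}"
          using st by (fastforce simp: c'_def d'_def)
        show "\<gamma> -` {c<..d} \<inter> {0..l} \<in> sets lborel"
          using measurable_sets[OF \<gamma>_meas, of "{c<..d}"]
          by (auto simp: space_restrict_space sets_restrict_space)
      qed
      also have "\<dots> = emeasure \<nu> {c<..d}" by (simp add: \<nu>_eq)
      finally show ?thesis .
    next
      case False
      then have "emeasure lborel {c'..d'} = 0" by (simp add: emeasure_lborel_Icc_eq)
      then show ?thesis by simp
    qed
    finally show "emeasure \<mu> {c<..d} \<le> emeasure \<nu> {c<..d}" .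
  qed
  then have "(\<integral>\<^sup>+x. g x \<partial>\<mu>) \<le> (\<integral>\<^sup>+x. g x \<partial>\<nu>)"
    by (intro nn_integral_mono_measure) (auto simp: \<mu>_def \<nu>_def)
  also have "(\<integral>\<^sup>+x. g x \<partial>\<mu>) = (\<integral>\<^sup>+x\<in>{a..b}. g x \<partial>lborel)"
    unfolding \<mu>_def by (subst nn_integral_density) (auto simp: mult.commute)
  also have "(\<integral>\<^sup>+x. g x \<partial>\<nu>) = (\<integral>\<^sup>+s. g (\<gamma> s) \<partial>restrict_space lborel {0..l})"
    unfolding \<nu>_def using \<gamma>_meas by (subst nn_integral_distr) auto
  also have "\<dots> = line_integral g \<gamma> l"
    unfolding line_integral_def
    by (simp add: nn_integral_restrict_space nn_integral_completion)
  finally show ?thesis by (simp add: a_def b_def)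
qed

section \<open>Weights and local integrability\<close>

lemma epow_1 [simp]: "epow x 1 = x"
  by (cases x) (auto simp: epow_def ennreal_enn2real_if)

lemma epow_zero: "0 < a \<Longrightarrow> epow 0 a = 0"
  by (simp add: epow_def)

lemma borel_measurable_epow [measurable]: "(\<lambda>x. epow x a) \<in> borel_measurable borel"
  unfolding epow_def by measurable

lemma epow_mono:
  assumes "0 < a" "x \<le> y"
  shows "epow x a \<le> epow y a"
proof (cases "y = \<infinity>")
  case False
  then have "enn2real x \<le> enn2real y"
    using assms(2) by (intro enn2real_mono) (auto simp: top.not_eq_extremum)
  then show ?thesis
    using assms False by (auto simp: epow_def top_unique intro!: ennreal_leI powr_mono2)
qed (use assms in \<open>auto simp: epow_def\<close>)

text \<open>Either \<open>g \<le> w powr (1 / (1 - p))\<close>, or \<open>g powr (p - 1) > 1 / w\<close> and hence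
  \<open>g \<le> w * g powr p\<close>. This takes the place of Hoelder's inequality.\<close>

lemma le_weighted_epow:
  fixes g w :: ennreal
  assumes "1 < p"
  shows "g \<le> w * epow g p + epow w (1 / (1 - p))"
proof (cases "w = 0 \<or> g = 0 \<or> w = \<infinity> \<or> g = \<infinity>")
  case True
  \<comment> \<open>The conventions of \<open>epow\<close> match: for \<open>w = 0\<close> the
    negative exponent makes the second summand infinite, and if one of \<open>w\<close>,
    \<open>g\<close> is infinite while the other is not zero, the first summand is infinite.\<close>
  then show ?thesis using assms by (auto simp: epow_def ennreal_mult_top ennreal_top_mult divide_less_0_iff enn2real_eq_0_iff)
next
  case False
  then obtain a b where ab: "w = ennreal a" "g = ennreal b" "0 < a" "0 < b"
    by (cases w; cases g) (auto simp: less_le)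
  have "b \<le> a * (b powr p) + a powr (1 / (1 - p))"
  proof (cases "b \<le> a powr (1 / (1 - p))")
    case True
    then show ?thesis using ab by (simp add: add_increasing)
  next
    case False
    have "1 / (1 - p) * (p - 1) = - 1" using assms by (simp add: field_simps)
    then have "(a powr (1 / (1 - p))) powr (p - 1) = a powr (- 1)" by (simp only: powr_powr)
    then have "1 / a = (a powr (1 / (1 - p))) powr (p - 1)"
      using ab by (simp add: powr_minus_divide)
    also have "\<dots> \<le> b powr (p - 1)"
      using False assms by (intro powr_mono2) auto
    finally have "1 \<le> a * b powr (p - 1)" using ab by (simp add: field_simps)
    then have "b * 1 \<le> b * (a * b powr (p - 1))" using ab by (intro mult_left_mono) auto
    also have "\<dots> = a * b powr p" using ab by (simp add: powr_diff)
    finally show ?thesis by (simp add: add_increasing2)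
  qed
  then show ?thesis
    using ab assms by (simp add: epow_def flip: ennreal_mult ennreal_plus)
qed

text \<open>A point with elements of \<open>I\<close> on both sides is interior, so any other point
  of \<open>I\<close> is its minimum or maximum. If \<open>I\<close> is unbounded, the unspecified
  value of \<open>Inf\<close> or \<open>Sup\<close> merely enlarges the right-hand side.\<close>

lemma interval_diff_interior:
  fixes I :: "real set"
  assumes "is_interval I"
  shows "I - interior I \<subseteq> {Inf I, Sup I}"
proof
  fix x assume x: "x \<in> I - interior I"
  have "(\<forall>y\<in>I. x \<le> y) \<or> (\<forall>y\<in>I. y \<le> x)"
  proof (rule ccontr)
    assume "\<not> ?thesis"
    then obtain y z where yz: "y \<in> I" "z \<in> I" "y < x" "x < z" by (auto simp: not_le)
    then have "{y<..<z} \<subseteq> I" using assms unfolding is_interval_1 by fastforce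
    then have "{y<..<z} \<subseteq> interior I" by (intro interior_maximal) auto
    then show False using x yz by auto
  qed
  then show "x \<in> {Inf I, Sup I}"
    using x cInf_eq_minimum[of x I] cSup_eq_maximum[of x I] by auto
qed

lemma is_interval_borel:
  fixes I :: "real set"
  assumes "is_interval I"
  shows "I \<in> sets borel"
proof -
  have "I = interior I \<union> (I - interior I)" using interior_subset by blast
  moreover have "finite (I - interior I)"
    using interval_diff_interior[OF assms] by (rule finite_subset) simp
  ultimately show ?thesis
    by (metis borel_open finite_imp_closed borel_closed open_interior sets.Un)
qed

lemma openin_interval_borel:
  fixes I :: "real set"
  assumes "is_interval I" "openin (top_of_set I) G"
  shows "G \<in> sets borel"
  using assms is_interval_borel[OF assms(1)] unfolding openin_open by auto

text \<open>Countably many intervals with rational end points suffice to cover the interior, so the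
  exceptional null sets can be united.\<close>

lemma AE_interior_if_AE_Ioo:
  fixes Y :: "real set"
  assumes "\<And>c d. c < d \<Longrightarrow> {c..d} \<subseteq> Y \<Longrightarrow> AE x in lebesgue. x \<in> {c<..<d} \<longrightarrow> P x"
  shows "AE x in lebesgue. x \<in> interior Y \<longrightarrow> P x"
proof -
  let ?Q = "{(c, d) \<in> \<rat> \<times> \<rat>. c < d \<and> {c..d} \<subseteq> Y}"
  have "countable ?Q"
    by (rule countable_subset[of _ "\<rat> \<times> \<rat>"]) (auto intro: countable_rat)
  then have "AE x in lebesgue. \<forall>q\<in>?Q. x \<in> {fst q<..<snd q} \<longrightarrow> P x"
    using assms by (subst AE_ball_countable) auto
  then show ?thesis
  proof (rule AE_mp, intro AE_I2 impI)
    fix x assume *: "\<forall>q\<in>?Q. x \<in> {fst q<..<snd q} \<longrightarrow> P x" and "x \<in> interior Y"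
    then obtain e where e: "0 < e" "ball x e \<subseteq> Y" by (auto simp: mem_interior)
    obtain c d where cd: "c \<in> \<rat>" "d \<in> \<rat>" "x - e < c" "c < x" "x < d" "d < x + e"
      using Rats_dense_in_real[of "x - e" x] Rats_dense_in_real[of x "x + e"] e(1) by auto
    then have "{c..d} \<subseteq> Y" using e(2) by (fastforce simp: subset_iff dist_real_def)
    with cd have "(c, d) \<in> ?Q" by auto
    with * cd show "P x" by fastforce
  qed
qed

text \<open>A relatively open set can contain end points of \<open>I\<close>, but no other points
  that fail to be interior.\<close>

lemma AE_interior_if_interval:
  fixes I :: "real set"
  assumes "is_interval I" "openin (top_of_set I) G"
  shows "AE x in lebesgue. x \<in> G \<longrightarrow> x \<in> interior G"
proof (rule AE_I')
  show "{Inf I, Sup I} \<in> null_sets lebesgue"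
    using negligible_finite[of "{Inf I, Sup I}"] by (simp add: negligible_iff_null_sets del: negligible_finite)
  obtain T where T: "open T" "G = I \<inter> T" using assms(2) unfolding openin_open by auto
  then have "interior G = interior I \<inter> T" by (simp add: interior_open)
  then show "{x \<in> space lebesgue. \<not> (x \<in> G \<longrightarrow> x \<in> interior G)} \<subseteq> {Inf I, Sup I}"
    using interval_diff_interior[OF assms(1)] T by auto
qed

text \<open>The passage from local to compact intervals, by Bolzano's bisection principle: a
  property that holds on all short intervals around each point and is inherited by unions of
  adjacent intervals holds on \<open>{a..b}\<close>.\<close>

lemma near_each_point_Icc:
  fixes I :: "real set"
  assumes near: "near_each_point I Q" and ab: "a \<le> b" "{a..b} \<subseteq> I"
    and loc: "\<And>G c d. openin (top_of_set I) G \<Longrightarrow> Q G \<Longrightarrow> a \<le> c \<Longrightarrow> c \<le> d \<Longrightarrow> d \<le> b \<Longrightarrow>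
      {c..d} \<subseteq> G \<Longrightarrow> P c d"
    and trans: "\<And>c d e. a \<le> c \<Longrightarrow> c \<le> d \<Longrightarrow> d \<le> e \<Longrightarrow> e \<le> b \<Longrightarrow> P c d \<Longrightarrow> P d e \<Longrightarrow> P c e"
  shows "P a b"
proof -
  \<comment> \<open>The short intervals of Bolzano's principle may stick out of
    \<open>{a..b}\<close>; the two guards make the predicate vacuous for those.\<close>
  have "a \<le> a \<longrightarrow> b \<le> b \<longrightarrow> P a b"
    using ab(1)
  proof (induction rule: Bolzano[where P = "\<lambda>c d. a \<le> c \<longrightarrow> d \<le> b \<longrightarrow> P c d"])
    case (trans c d e)
    then show ?case using assms(5)[of c d e] by auto
  next
    case (local x)
    then obtain G where G: "openin (top_of_set I) G" "x \<in> G" "Q G"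
      using near ab unfolding near_each_point_def by (metis atLeastAtMost_iff subset_iff)
    then obtain e where e: "0 < e" "ball x e \<inter> I \<subseteq> G"
      unfolding openin_contains_ball by auto
    have "P c d" if "c \<le> x" "x \<le> d" "d - c < e" "a \<le> c" "d \<le> b" for c d
    proof -
      have "{c..d} \<subseteq> ball x e" using that by (auto simp: dist_real_def)
      moreover have "{c..d} \<subseteq> I" using that ab(2) by auto
      ultimately have "{c..d} \<subseteq> G" using e(2) by auto
      then show ?thesis using loc[OF G(1,3)] that by auto
    qed
    then show ?case using e(1) by blast
  qed
  then show ?thesis by simp
qed

text \<open>Multiplying by the indicator constrains \<open>v\<close> on the interval only, while all
  intervals share one measure space, so that integrals over adjacent ones can be added.\<close>

definition integrable_on_Icc :: "(real \<Rightarrow> ennreal) \<Rightarrow> real \<Rightarrow> real \<Rightarrow> bool" where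
  "integrable_on_Icc v a b \<longleftrightarrow>
     (\<lambda>x. v x * indicator {a..b} x) \<in> borel_measurable lebesgue \<and>
     (\<integral>\<^sup>+x\<in>{a..b}. v x \<partial>lebesgue) < \<infinity>"

lemma integrable_on_Icc_subset:
  assumes "integrable_on_Icc v a b" "a \<le> c" "d \<le> b"
  shows "integrable_on_Icc v c d"
proof -
  have eq: "v x * indicator {c..d} x = (v x * indicator {a..b} x) * indicator {c..d} x" for x
    using assms by (auto split: split_indicator)
  have "(\<integral>\<^sup>+x\<in>{c..d}. v x \<partial>lebesgue) \<le> (\<integral>\<^sup>+x\<in>{a..b}. v x \<partial>lebesgue)"
    using assms by (intro nn_integral_mono) (auto split: split_indicator)
  then show ?thesis
    using assms unfolding integrable_on_Icc_def eq
    by (auto intro!: borel_measurable_times_ennreal borel_measurable_indicator)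
qed

lemma integrable_on_Icc_combine:
  assumes "integrable_on_Icc v c d" "integrable_on_Icc v d e" "c \<le> d" "d \<le> e"
  shows "integrable_on_Icc v c e"
proof -
  \<comment> \<open>The intervals share the point \<open>d\<close>, which a sum would count twice;
    the maximum does not.\<close>
  have eq: "v x * indicator {c..e} x = max (v x * indicator {c..d} x) (v x * indicator {d..e} x)" for x
    using assms(3,4) by (auto split: split_indicator)
  have "(\<integral>\<^sup>+x\<in>{c..e}. v x \<partial>lebesgue)
      \<le> (\<integral>\<^sup>+x. v x * indicator {c..d} x + v x * indicator {d..e} x \<partial>lebesgue)"
    by (intro nn_integral_mono) (auto split: split_indicator)
  also have "\<dots> = (\<integral>\<^sup>+x\<in>{c..d}. v x \<partial>lebesgue) + (\<integral>\<^sup>+x\<in>{d..e}. v x \<partial>lebesgue)"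
    using assms unfolding integrable_on_Icc_def by (intro nn_integral_add) auto
  also have "\<dots> < \<infinity>"
    using assms unfolding integrable_on_Icc_def by simp
  finally show ?thesis
    using assms unfolding integrable_on_Icc_def eq by auto
qed

text \<open>A bridge to the differentiation results, which concern real functions integrable over
  \<open>lborel\<close>: choose a Borel representative and let \<open>enn2real\<close> send the
  value infinity, attained on a null set only, to 0.\<close>

lemma integrable_on_Icc_real:
  assumes "integrable_on_Icc v a b"
  obtains H :: "real \<Rightarrow> real" where "integrable lborel H" "\<And>x. 0 \<le> H x"
    "AE x in lebesgue. x \<in> {a..b} \<longrightarrow> v x = ennreal (H x)"
    "\<And>x y. a \<le> x \<Longrightarrow> y \<le> b \<Longrightarrow> (\<integral>\<^sup>+t\<in>{x..y}. v t \<partial>lebesgue) = ennreal (LINT t:{x..y}|lborel. H t)"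
proof -
  have v: "(\<lambda>x. v x * indicator {a..b} x) \<in> borel_measurable (completion lborel)"
    and fin: "(\<integral>\<^sup>+x. v x * indicator {a..b} x \<partial>lborel) < \<infinity>"
    using assms unfolding integrable_on_Icc_def by (auto simp: nn_integral_completion)
  obtain h where h[measurable]: "h \<in> borel_measurable lborel"
    and h_eq: "AE x in lborel. v x * indicator {a..b} x = h x"
    using completion_ex_borel_measurable[OF v] by auto
  have fin_h: "(\<integral>\<^sup>+x. h x \<partial>lborel) < \<infinity>"
    using fin nn_integral_cong_AE[OF h_eq] by simp
  then have "AE x in lborel. h x \<noteq> \<infinity>"
    by (intro nn_integral_noteq_infinite) auto
  then have H_eq: "AE x in lborel. ennreal (enn2real (h x)) = v x * indicator {a..b} x"
    using h_eq by eventually_elim (auto simp: top.not_eq_extremum)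
  have H_int: "integrable lborel (\<lambda>x. enn2real (h x))"
  proof (rule integrableI_nonneg)
    show "(\<integral>\<^sup>+x. ennreal (enn2real (h x)) \<partial>lborel) < \<infinity>"
      using fin nn_integral_cong_AE[OF H_eq] by simp
  qed auto
  show ?thesis
  proof (rule that[OF H_int])
    have "AE x in lebesgue. ennreal (enn2real (h x)) = v x * indicator {a..b} x"
      using H_eq by (rule AE_completion)
    then show "AE x in lebesgue. x \<in> {a..b} \<longrightarrow> v x = ennreal (enn2real (h x))"
      by eventually_elim auto
    fix x y assume xy: "a \<le> x" "y \<le> b"
    have "(\<integral>\<^sup>+t\<in>{x..y}. v t \<partial>lebesgue) = (\<integral>\<^sup>+t\<in>{x..y}. v t \<partial>lborel)"
      by (simp add: nn_integral_completion)
    also have "\<dots> = (\<integral>\<^sup>+t. ennreal (indicator {x..y} t *\<^sub>R enn2real (h t)) \<partial>lborel)"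
      using H_eq xy by (intro nn_integral_cong_AE) (auto elim!: eventually_mono split: split_indicator)
    also have "\<dots> = ennreal (LINT t:{x..y}|lborel. enn2real (h t))"
      unfolding set_lebesgue_integral_def
      by (intro nn_integral_eq_integral integrable_mult_indicator H_int) auto
    finally show "(\<integral>\<^sup>+t\<in>{x..y}. v t \<partial>lebesgue) = ennreal (LINT t:{x..y}|lborel. enn2real (h t))" .
  qed simp
qed

text \<open>Completing \<open>w dx\<close> adds all subsets of its null sets, even non-measurable
  ones where \<open>w\<close> vanishes. As \<open>w\<close> is nonzero a.e. on \<open>Y\<close>,
  these null sets meet \<open>Y\<close> in Lebesgue null sets, and completing adds nothing
  there.\<close>

lemma restrict_completion_density:
  fixes w :: "real \<Rightarrow> ennreal"
  assumes w[measurable]: "w \<in> borel_measurable lebesgue" and Y: "Y \<in> sets lebesgue"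
    and pos: "AE x in lebesgue. x \<in> Y \<longrightarrow> w x \<noteq> 0"
  shows "restrict_space (completion (density lebesgue w)) Y = density (lebesgue_on Y) w"
proof (rule measure_eqI)
  let ?N = "density lebesgue w"
  have Y_in: "Y \<inter> space (completion ?N) \<in> sets (completion ?N)" using Y by auto
  have sets_eq: "sets (restrict_space (completion ?N) Y) = sets (lebesgue_on Y)"
  proof -
    have "A \<inter> Y \<in> sets lebesgue" if "A \<in> sets (completion ?N)" for A
    proof -
      from that obtain S N N' where A: "A = S \<union> N" "N \<subseteq> N'" "N' \<in> null_sets ?N" "S \<in> sets ?N"
        by (rule sets_completionE)
      then have N': "N' \<in> sets lebesgue" "AE x in lebesgue. x \<in> N' \<longrightarrow> w x = 0"
        by (auto simp: null_sets_density_iff)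
      have "AE x in lebesgue. x \<notin> N' \<inter> Y"
        using N'(2) pos by eventually_elim auto
      then have "N' \<inter> Y \<in> null_sets lebesgue"
        using N'(1) Y by (subst (asm) AE_iff_null_sets[symmetric]) auto
      then have "N \<inter> Y \<in> null_sets lebesgue"
        using A(2) by (intro null_sets_completion_subset[of "N \<inter> Y" "N' \<inter> Y"]) auto
      moreover have "A \<inter> Y = (S \<inter> Y) \<union> (N \<inter> Y)" using A(1) by auto
      ultimately show ?thesis using A(4) Y by auto
    qed
    then show ?thesis
      using Y by (auto simp: sets_restrict_space image_iff)
  qed
  then show "sets (restrict_space (completion ?N) Y) = sets (density (lebesgue_on Y) w)" by simp
  fix A assume "A \<in> sets (restrict_space (completion ?N) Y)"
  then have A: "A \<in> sets lebesgue" "A \<subseteq> Y" "A \<in> sets (lebesgue_on Y)"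
    using sets_eq Y by (auto simp: sets_restrict_space)
  have wY: "w \<in> borel_measurable (lebesgue_on Y)" by (rule measurable_restrict_space1) measurable
  have "emeasure (restrict_space (completion ?N) Y) A = emeasure (completion ?N) A"
    using A Y_in by (intro emeasure_restrict_space) auto
  also have "\<dots> = emeasure ?N A" using A by (simp add: emeasure_completion)
  also have "\<dots> = (\<integral>\<^sup>+x. w x * indicator A x \<partial>lebesgue)"
    using A by (intro emeasure_density) auto
  also have "\<dots> = (\<integral>\<^sup>+x. w x * indicator A x \<partial>lebesgue_on Y)"
    using A Y by (subst nn_integral_restrict_space) (auto intro!: nn_integral_cong split: split_indicator)
  also have "\<dots> = emeasure (density (lebesgue_on Y) w) A"
    using A wY by (intro emeasure_density[symmetric]) auto
  finally show "emeasure (restrict_space (completion ?N) Y) A = emeasure (density (lebesgue_on Y) w) A" .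
qed

section \<open>Increments of extended real functions\<close>

lemma ereal_gap_eq:
  assumes "\<bar>a\<bar> \<noteq> \<infinity>" "\<bar>b\<bar> \<noteq> \<infinity>"
  shows "ereal_gap a b = ennreal \<bar>real_of_ereal b - real_of_ereal a\<bar>"
  using assms by (cases a; cases b) (auto simp: ereal_gap_def abs_minus_commute)

lemma ereal_gap_triangle: "ereal_gap a c \<le> ereal_gap a b + ereal_gap b c"
proof (cases "\<bar>a\<bar> = \<infinity> \<or> \<bar>b\<bar> = \<infinity> \<or> \<bar>c\<bar> = \<infinity>")
  case True
  then show ?thesis by (auto simp: ereal_gap_def)
next
  case False
  then show ?thesis
    by (auto simp: ereal_gap_eq simp flip: ennreal_plus intro!: ennreal_leI)
qed

text \<open>The strict \<open>x < y\<close> corresponds to nonconstant curves. At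
  \<open>x = y\<close> the integral is 0 while the gap of an infinite value with itself is infinite,
  so finiteness of \<open>u\<close> would be built in rather than derived.\<close>

definition gap_le_integral :: "(real \<Rightarrow> ereal) \<Rightarrow> (real \<Rightarrow> ennreal) \<Rightarrow> real \<Rightarrow> real \<Rightarrow> bool" where
  "gap_le_integral u k a b \<longleftrightarrow>
     (\<forall>x y. a \<le> x \<longrightarrow> x < y \<longrightarrow> y \<le> b \<longrightarrow> ereal_gap (u x) (u y) \<le> (\<integral>\<^sup>+t\<in>{x..y}. k t \<partial>lebesgue))"

lemma gap_le_integral_if_ug_inequality:
  assumes k: "k \<in> borel_measurable (lebesgue_on {a..b})"
    and ug: "\<And>x y. a \<le> x \<Longrightarrow> x < y \<Longrightarrow> y \<le> b \<Longrightarrow> ug_inequality u k (\<lambda>s. x + s) (y - x)"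
  shows "gap_le_integral u k a b"
  unfolding gap_le_integral_def
proof (intro allI impI)
  fix x y assume xy: "a \<le> x" "x < y" "y \<le> b"
  have "ereal_gap (u x) (u y) \<le> line_integral k (\<lambda>s. x + s) (y - x)"
    using ug[OF xy] by (simp add: ug_inequality_def)
  also have "\<dots> = (\<integral>\<^sup>+t. k t \<partial>lebesgue_on {x..y})"
    using xy by (intro line_integral_segment measurable_restrict_mono[OF k]) auto
  also have "\<dots> = (\<integral>\<^sup>+t\<in>{x..y}. k t \<partial>lebesgue)"
    by (subst nn_integral_restrict_space) auto
  finally show "ereal_gap (u x) (u y) \<le> (\<integral>\<^sup>+t\<in>{x..y}. k t \<partial>lebesgue)" .
qed

text \<open>Membership in the local Newtonian space provides unrelated upper gradients on different
  neighbourhoods; this glues them. An increment across \<open>d\<close> is split there by the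
  triangle inequality.\<close>

lemma gap_le_integral_combine:
  assumes h1: "integrable_on_Icc h1 c d" "gap_le_integral u h1 c d"
    and h2: "integrable_on_Icc h2 d e" "gap_le_integral u h2 d e" and "c \<le> d" "d \<le> e"
  obtains h where "integrable_on_Icc h c e" "gap_le_integral u h c e"
proof -
  define h where "h t = h1 t * indicator {c..d} t + h2 t * indicator {d..e} t" for t
  have h_meas: "h \<in> borel_measurable lebesgue"
    using h1(1) h2(1) unfolding h_def integrable_on_Icc_def by (intro borel_measurable_add) auto
  have "(\<integral>\<^sup>+x\<in>{c..e}. h x \<partial>lebesgue) \<le> (\<integral>\<^sup>+x. h x \<partial>lebesgue)"
    by (intro nn_integral_mono) (auto split: split_indicator)
  also have "\<dots> = (\<integral>\<^sup>+x\<in>{c..d}. h1 x \<partial>lebesgue) + (\<integral>\<^sup>+x\<in>{d..e}. h2 x \<partial>lebesgue)"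
    using h1(1) h2(1) unfolding h_def integrable_on_Icc_def by (intro nn_integral_add) auto
  also have "\<dots> < \<infinity>" using h1(1) h2(1) by (simp add: integrable_on_Icc_def)
  finally have int: "integrable_on_Icc h c e"
    unfolding integrable_on_Icc_def using h_meas
    by (auto intro!: borel_measurable_times_ennreal borel_measurable_indicator)
  have gap1: "ereal_gap (u x) (u y) \<le> (\<integral>\<^sup>+t\<in>{x..y}. h1 t \<partial>lebesgue)" if "c \<le> x" "x < y" "y \<le> d" for x y
    using h1(2) that unfolding gap_le_integral_def by blast
  have gap2: "ereal_gap (u x) (u y) \<le> (\<integral>\<^sup>+t\<in>{x..y}. h2 t \<partial>lebesgue)" if "d \<le> x" "x < y" "y \<le> e" for x y
    using h2(2) that unfolding gap_le_integral_def by blast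
  have "ereal_gap (u x) (u y) \<le> (\<integral>\<^sup>+t\<in>{x..y}. h t \<partial>lebesgue)" if xy: "c \<le> x" "x < y" "y \<le> e" for x y
  proof -
    consider "y \<le> d" | "d \<le> x" | "x < d" "d < y" by linarith
    then show ?thesis
    proof cases
      case 1
      note gap1[OF xy(1,2) 1]
      also have "(\<integral>\<^sup>+t\<in>{x..y}. h1 t \<partial>lebesgue) \<le> (\<integral>\<^sup>+t\<in>{x..y}. h t \<partial>lebesgue)"
        using 1 xy by (intro nn_integral_mono) (auto simp: h_def split: split_indicator)
      finally show ?thesis .
    next
      case 2
      note gap2[OF 2 xy(2,3)]
      also have "(\<integral>\<^sup>+t\<in>{x..y}. h2 t \<partial>lebesgue) \<le> (\<integral>\<^sup>+t\<in>{x..y}. h t \<partial>lebesgue)"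
        using 2 xy by (intro nn_integral_mono) (auto simp: h_def split: split_indicator)
      finally show ?thesis .
    next
      case 3
      have "ereal_gap (u x) (u y) \<le> ereal_gap (u x) (u d) + ereal_gap (u d) (u y)"
        by (rule ereal_gap_triangle)
      also have "\<dots> \<le> (\<integral>\<^sup>+t\<in>{x..d}. h1 t \<partial>lebesgue) + (\<integral>\<^sup>+t\<in>{d..y}. h2 t \<partial>lebesgue)"
        using 3 xy by (intro add_mono gap1 gap2) auto
      also have "\<dots> = (\<integral>\<^sup>+t. h1 t * indicator {x..d} t + h2 t * indicator {d..y} t \<partial>lebesgue)"
        using integrable_on_Icc_subset[OF h1(1) xy(1) order.refl]
          integrable_on_Icc_subset[OF h2(1) order.refl xy(3)]
        unfolding integrable_on_Icc_def by (intro nn_integral_add[symmetric]) auto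
      also have "\<dots> \<le> (\<integral>\<^sup>+t\<in>{x..y}. h t \<partial>lebesgue)"
        using 3 xy by (intro nn_integral_mono) (auto simp: h_def split: split_indicator)
      finally show ?thesis .
    qed
  qed
  then have "gap_le_integral u h c e" unfolding gap_le_integral_def by blast
  with int show ?thesis by (rule that)
qed

text \<open>An infinite value at \<open>x\<close> has infinite gap to every other point, whereas the
  integral is finite; \<open>a < b\<close> supplies that other point.\<close>

lemma gap_le_integral_finite:
  assumes "integrable_on_Icc h a b" "gap_le_integral u h a b" "a < b" "x \<in> {a..b}"
  shows "\<bar>u x\<bar> \<noteq> \<infinity>"
proof -
  obtain y z where yz: "a \<le> y" "y < z" "z \<le> b" "x = y \<or> x = z"
  proof (cases "x = b")
    case True
    then show ?thesis using that[of a b] assms(3) by simp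
  next
    case False
    then show ?thesis using that[of x b] assms(4) by simp
  qed
  have "ereal_gap (u y) (u z) \<le> (\<integral>\<^sup>+t\<in>{y..z}. h t \<partial>lebesgue)"
    using assms(2) yz unfolding gap_le_integral_def by blast
  also have "\<dots> < \<infinity>"
    using integrable_on_Icc_subset[OF assms(1) yz(1,3)] by (simp add: integrable_on_Icc_def)
  finally show ?thesis using yz(4) by (auto simp: ereal_gap_def split: if_splits)
qed

lemma gap_le_integral_real:
  assumes h: "integrable_on_Icc h a b" "gap_le_integral u h a b" and "a < b"
  obtains H :: "real \<Rightarrow> real" where "integrable lborel H" "\<And>x. 0 \<le> H x"
    "AE x in lebesgue. x \<in> {a..b} \<longrightarrow> h x = ennreal (H x)"
    "\<And>x y. a \<le> x \<Longrightarrow> x \<le> y \<Longrightarrow> y \<le> b \<Longrightarrow>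
      \<bar>real_of_ereal (u y) - real_of_ereal (u x)\<bar> \<le> (LINT t:{x..y}|lborel. H t)"
proof -
  obtain H :: "real \<Rightarrow> real" where H: "integrable lborel H" "\<And>x. 0 \<le> H x"
    "AE x in lebesgue. x \<in> {a..b} \<longrightarrow> h x = ennreal (H x)"
    "\<And>x y. a \<le> x \<Longrightarrow> y \<le> b \<Longrightarrow> (\<integral>\<^sup>+t\<in>{x..y}. h t \<partial>lebesgue) = ennreal (LINT t:{x..y}|lborel. H t)"
    using integrable_on_Icc_real[OF h(1)] by blast
  have H_nonneg: "0 \<le> (LINT t:{x..y}|lborel. H t)" for x y
    unfolding set_lebesgue_integral_def by (intro integral_nonneg_AE) (auto simp: H(2))
  show ?thesis
  proof (rule that[OF H(1-3)])
    fix x y assume xy: "a \<le> x" "x \<le> y" "y \<le> b"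
    show "\<bar>real_of_ereal (u y) - real_of_ereal (u x)\<bar> \<le> (LINT t:{x..y}|lborel. H t)"
    proof (cases "x = y")
      case False
      then have "ereal_gap (u x) (u y) \<le> ennreal (LINT t:{x..y}|lborel. H t)"
        using h(2)[unfolded gap_le_integral_def, rule_format, of x y] xy H(4)[of x y] by simp
      moreover have "\<bar>u x\<bar> \<noteq> \<infinity>" "\<bar>u y\<bar> \<noteq> \<infinity>"
        using gap_le_integral_finite[OF h \<open>a < b\<close>] xy by auto
      ultimately show ?thesis
        using H_nonneg by (simp add: ereal_gap_eq)
    qed (use H_nonneg[of y y] in simp)
  qed
qed

text \<open>A function whose increments are dominated by the integral of \<open>K\<close> has \<open>|D| \<le> K\<close>
  wherever it has derivative \<open>D\<close> and the primitive of \<open>K\<close> has derivative \<open>K\<close>: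
  the primitive plus or minus the function is monotone.\<close>

lemma AE_abs_derivative_le:
  fixes U K :: "real \<Rightarrow> real"
  assumes K: "integrable lborel K"
    and U: "\<And>x y. a \<le> x \<Longrightarrow> x \<le> y \<Longrightarrow> y \<le> b \<Longrightarrow> \<bar>U y - U x\<bar> \<le> (LINT t:{x..y}|lborel. K t)"
  shows "AE x in lebesgue. x \<in> {a<..<b} \<longrightarrow> (\<forall>D. (U has_real_derivative D) (at x) \<longrightarrow> \<bar>D\<bar> \<le> K x)"
proof -
  define V where "V x = (LINT t:{a..x}|lborel. K t)" for x
  have V: "V y - V x = (LINT t:{x..y}|lborel. K t)" if "a \<le> x" "x \<le> y" "y \<le> b" for x y
    unfolding V_def using set_integral_Icc_combine[OF K that(1,2)] by simp
  have "AE x in lebesgue. x \<in> {a<..<b} \<longrightarrow> (V has_real_derivative K x) (at x)"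
    by (rule AE_has_real_derivative_indefinite_integral[OF K V])
  then show ?thesis
  proof eventually_elim
    case (elim x)
    show ?case
    proof (intro impI allI)
      fix D assume x: "x \<in> {a<..<b}" and D: "(U has_real_derivative D) (at x)"
      have dV: "(V has_real_derivative K x) (at x)" using elim x by blast
      have int: "x \<in> interior {a..b}" using x by simp
      have "V y - U y \<le> V z - U z \<and> V y + U y \<le> V z + U z" if "a \<le> y" "y \<le> z" "z \<le> b" for y z
        using U[OF that] V[OF that] by linarith
      then have "mono_on {a..b} (\<lambda>y. V y - U y)" "mono_on {a..b} (\<lambda>y. V y + U y)"
        by (simp_all add: monotone_on_def)
      from mono_on_imp_deriv_nonneg[OF this(1) DERIV_diff[OF dV D] int]
        mono_on_imp_deriv_nonneg[OF this(2) DERIV_add[OF dV D] int]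
      show "\<bar>D\<bar> \<le> K x" by linarith
    qed
  qed
qed

lemma abs_continuous_on_imp_continuous_on:
  assumes "abs_continuous_on a b f"
  shows "continuous_on {a..b} f"
  unfolding continuous_on_iff
proof (intro ballI allI impI)
  fix x e :: real assume x: "x \<in> {a..b}" and "0 < e"
  then obtain d where "0 < d" and d: "\<forall>(n::nat) s t. (\<forall>i<n. a \<le> s i \<and> s i \<le> t i \<and> t i \<le> b) \<and>
      disjoint_family_on (\<lambda>i. {s i<..<t i}) {..<n} \<and> (\<Sum>i<n. t i - s i) < d \<longrightarrow>
      (\<Sum>i<n. \<bar>f (t i) - f (s i)\<bar>) < e"
    using assms unfolding abs_continuous_on_def by blast
  have *: "\<bar>f y - f z\<bar> < e" if "a \<le> z" "z \<le> y" "y \<le> b" "y - z < d" for y z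
    using d[rule_format, of 1 "\<lambda>_. z" "\<lambda>_. y"] that by (simp add: disjoint_family_on_def)
  show "\<exists>d>0. \<forall>x'\<in>{a..b}. dist x' x < d \<longrightarrow> dist (f x') (f x) < e"
  proof (intro exI[of _ d] conjI ballI impI)
    fix y assume "y \<in> {a..b}" "dist y x < d"
    then show "dist (f y) (f x) < e"
      using *[of y x] *[of x y] x by (cases "x \<le> y") (auto simp: dist_real_def abs_minus_commute)
  qed fact
qed

section \<open>Upper gradients on weighted intervals\<close>

lemma integrable_on_Icc_if_nn_integral:
  assumes "v \<in> borel_measurable (lebesgue_on G)" "(\<integral>\<^sup>+x. v x \<partial>lebesgue_on G) < \<infinity>"
    and "G \<in> sets lebesgue" "{c..d} \<subseteq> G"
  shows "integrable_on_Icc v c d"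
proof -
  have "v \<in> borel_measurable (lebesgue_on {c..d})"
    using assms by (intro measurable_restrict_mono[OF assms(1)])
  then have "(\<lambda>x. v x * indicator {c..d} x) \<in> borel_measurable lebesgue"
    by (subst (asm) borel_measurable_restrict_space_iff_ennreal) auto
  moreover have "(\<integral>\<^sup>+x\<in>{c..d}. v x \<partial>lebesgue) \<le> (\<integral>\<^sup>+x\<in>G. v x \<partial>lebesgue)"
    using assms(4) by (intro nn_integral_mono) (auto split: split_indicator)
  moreover have "(\<integral>\<^sup>+x\<in>G. v x \<partial>lebesgue) < \<infinity>"
    using assms(2,3) by (subst (asm) nn_integral_restrict_space) auto
  ultimately show ?thesis unfolding integrable_on_Icc_def by auto
qed

lemma borel_measurable_lebesgue_on:
  assumes "g \<in> borel_measurable (restrict_space borel G)" "G \<in> sets borel"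
  shows "(g :: real \<Rightarrow> ennreal) \<in> borel_measurable (lebesgue_on G)"
proof -
  have "(\<lambda>x. g x * indicator G x) \<in> borel_measurable lborel"
    using assms by (subst (asm) borel_measurable_restrict_space_iff_ennreal) auto
  then have "(\<lambda>x. g x * indicator G x) \<in> borel_measurable lebesgue"
    by (rule measurable_completion)
  then show ?thesis
    using assms by (subst borel_measurable_restrict_space_iff_ennreal) auto
qed

text \<open>The function in \<open>dual\<close> is the dual weight:
  \<open>1 / (1 - p) = 1 - q\<close> for the conjugate exponent
  \<open>q = p / (p - 1)\<close>.\<close>

locale weighted_interval =
  fixes M :: "real measure" and w :: "real \<Rightarrow> ennreal" and p :: real and I :: "real set"
  assumes p: "1 < p" and I: "is_interval I"
    and w [measurable]: "w \<in> borel_measurable lebesgue"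
    and M: "M = completion (density lebesgue w)"
    and dual: "in_Lp_loc 1 lebesgue I (\<lambda>x. epow (w x) (1 / (1 - p)))"
begin

lemma borel_if_openin: "openin (top_of_set I) G \<Longrightarrow> G \<in> sets borel"
  using openin_interval_borel[OF I] .

lemma dual_integrable_on_Icc:
  assumes "a \<le> b" "{a..b} \<subseteq> I"
  shows "integrable_on_Icc (\<lambda>x. epow (w x) (1 / (1 - p))) a b"
proof (rule near_each_point_Icc[OF dual[unfolded in_Lp_loc_def] assms])
  fix G c d assume "openin (top_of_set I) G" "in_Lp 1 lebesgue G (\<lambda>x. epow (w x) (1 / (1 - p)))"
    "{c..d} \<subseteq> G"
  then show "integrable_on_Icc (\<lambda>x. epow (w x) (1 / (1 - p))) c d"
    using borel_if_openin[of G]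
    by (intro integrable_on_Icc_if_nn_integral[of _ G]) (auto simp: in_Lp_def)
qed (rule integrable_on_Icc_combine)

text \<open>Where \<open>w\<close> vanishes, its negative power is infinite, and a function with
  finite integral is finite almost everywhere.\<close>

lemma AE_weight_nonzero: "AE x in lebesgue. x \<in> I \<longrightarrow> w x \<noteq> 0"
proof -
  have "AE x in lebesgue. x \<in> interior I \<longrightarrow> w x \<noteq> 0"
  proof (rule AE_interior_if_AE_Ioo)
    fix c d assume cd: "c < d" "{c..d} \<subseteq> I"
    then have "integrable_on_Icc (\<lambda>x. epow (w x) (1 / (1 - p))) c d"
      by (intro dual_integrable_on_Icc) auto
    then have "AE x in lebesgue. epow (w x) (1 / (1 - p)) * indicator {c..d} x \<noteq> \<infinity>"
      unfolding integrable_on_Icc_def by (intro nn_integral_noteq_infinite) auto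
    then show "AE x in lebesgue. x \<in> {c<..<d} \<longrightarrow> w x \<noteq> 0"
      by eventually_elim (use p in \<open>auto simp: epow_def divide_less_0_iff\<close>)
  qed
  then show ?thesis
    using AE_interior_if_interval[OF I openin_subtopology_self] by eventually_elim auto
qed

lemma restrict_space_eq_density:
  assumes "G \<in> sets borel" "G \<subseteq> I"
  shows "restrict_space M G = density (lebesgue_on G) w"
  unfolding M using assms AE_weight_nonzero
  by (intro restrict_completion_density) (auto elim!: eventually_mono)

lemma measurable_weight: "w \<in> borel_measurable (lebesgue_on G)"
  by (rule measurable_restrict_space1) measurable

lemma borel_measurable_restrict_space_eq:
  assumes "G \<in> sets borel" "G \<subseteq> I"
  shows "borel_measurable (restrict_space M G) = borel_measurable (lebesgue_on G)"
  unfolding restrict_space_eq_density[OF assms] by (rule measurable_cong_sets) auto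

lemma in_Lp_iff:
  fixes f :: "real \<Rightarrow> ennreal"
  assumes "G \<in> sets borel" "G \<subseteq> I"
  shows "in_Lp p M G f \<longleftrightarrow>
    f \<in> borel_measurable (lebesgue_on G) \<and> (\<integral>\<^sup>+x. w x * epow (f x) p \<partial>lebesgue_on G) < \<infinity>"
proof (cases "f \<in> borel_measurable (lebesgue_on G)")
  case True
  have "(\<lambda>x. epow (f x) p) \<in> borel_measurable (lebesgue_on G)"
    using True by measurable
  then show ?thesis
    using True unfolding in_Lp_def borel_measurable_restrict_space_eq[OF assms]
    by (subst restrict_space_eq_density[OF assms])
      (simp add: nn_integral_density[OF measurable_weight])
next
  case False
  then show ?thesis unfolding in_Lp_def borel_measurable_restrict_space_eq[OF assms] by simp
qed

lemma AE_restrict_space_iff: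
  assumes "G \<in> sets borel" "G \<subseteq> I"
  shows "(AE x in restrict_space M G. P x) \<longleftrightarrow> (AE x in lebesgue. x \<in> G \<longrightarrow> P x)"
proof -
  have "(AE x in restrict_space M G. P x) \<longleftrightarrow> (AE x in lebesgue. x \<in> G \<longrightarrow> 0 < w x \<longrightarrow> P x)"
    unfolding restrict_space_eq_density[OF assms] AE_density[OF measurable_weight]
    using assms by (subst AE_restrict_space_iff) auto
  also have "\<dots> \<longleftrightarrow> (AE x in lebesgue. x \<in> G \<longrightarrow> P x)"
  proof
    assume "AE x in lebesgue. x \<in> G \<longrightarrow> 0 < w x \<longrightarrow> P x"
    then show "AE x in lebesgue. x \<in> G \<longrightarrow> P x"
      using AE_weight_nonzero
      by eventually_elim (use assms(2) in \<open>auto simp: zero_less_iff_neq_zero\<close>)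
  qed auto
  finally show ?thesis .
qed

lemma in_Lp_imp_integrable_on_Icc:
  assumes k: "in_Lp p M G k" and G: "G \<in> sets borel" "G \<subseteq> I" and cd: "c \<le> d" "{c..d} \<subseteq> G"
  shows "integrable_on_Icc k c d"
proof -
  let ?v = "\<lambda>x. epow (w x) (1 / (1 - p))"
  have v: "integrable_on_Icc ?v c d" using cd G by (intro dual_integrable_on_Icc) auto
  have k': "k \<in> borel_measurable (lebesgue_on G)"
    "(\<integral>\<^sup>+x. w x * epow (k x) p \<partial>lebesgue_on G) < \<infinity>"
    using k in_Lp_iff[OF G] by auto
  have wk: "integrable_on_Icc (\<lambda>x. w x * epow (k x) p) c d"
    using k' G cd measurable_weight
    by (intro integrable_on_Icc_if_nn_integral[of _ G]) (auto intro!: borel_measurable_times_ennreal measurable_compose[OF _ borel_measurable_epow])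
  have "k \<in> borel_measurable (lebesgue_on {c..d})"
    using cd by (intro measurable_restrict_mono[OF k'(1)])
  then have "(\<lambda>x. k x * indicator {c..d} x) \<in> borel_measurable lebesgue"
    by (subst (asm) borel_measurable_restrict_space_iff_ennreal) auto
  moreover have "(\<integral>\<^sup>+x\<in>{c..d}. k x \<partial>lebesgue) < \<infinity>"
  proof -
    have "(\<integral>\<^sup>+x\<in>{c..d}. k x \<partial>lebesgue) \<le>
        (\<integral>\<^sup>+x. w x * epow (k x) p * indicator {c..d} x + ?v x * indicator {c..d} x \<partial>lebesgue)"
      using le_weighted_epow[OF p] by (intro nn_integral_mono) (auto split: split_indicator)
    also have "\<dots> = (\<integral>\<^sup>+x\<in>{c..d}. (w x * epow (k x) p) \<partial>lebesgue) + (\<integral>\<^sup>+x\<in>{c..d}. ?v x \<partial>lebesgue)"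
      using v wk unfolding integrable_on_Icc_def by (intro nn_integral_add) auto
    also have "\<dots> < \<infinity>"
      using v wk unfolding integrable_on_Icc_def by simp
    finally show ?thesis .
  qed
  ultimately show ?thesis unfolding integrable_on_Icc_def by auto
qed

lemma in_Lp_loc_imp_integrable_on_Icc:
  assumes "in_Lp_loc p M I k" "a \<le> b" "{a..b} \<subseteq> I"
  shows "integrable_on_Icc k a b"
proof (rule near_each_point_Icc[OF assms(1)[unfolded in_Lp_loc_def] assms(2,3)])
  fix G c d assume "openin (top_of_set I) G" "in_Lp p M G k" "c \<le> d" "{c..d} \<subseteq> G"
  then show "integrable_on_Icc k c d"
    by (intro in_Lp_imp_integrable_on_Icc[of G]) (auto intro: borel_if_openin dest: openin_imp_subset)
qed (rule integrable_on_Icc_combine)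

lemma upper_gradient_gap_le_integral:
  assumes g: "upper_gradient G u g" and G: "G \<in> sets borel" and ab: "{a..b} \<subseteq> G"
  shows "gap_le_integral u g a b"
proof (rule gap_le_integral_if_ug_inequality)
  have "g \<in> borel_measurable (lebesgue_on G)"
    using g G by (intro borel_measurable_lebesgue_on) (auto simp: upper_gradient_def)
  then show "g \<in> borel_measurable (lebesgue_on {a..b})"
    by (rule measurable_restrict_mono) fact
  fix x y assume "a \<le> x" "x < y" "y \<le> b"
  then show "ug_inequality u g (\<lambda>s. x + s) (y - x)"
    using g arc_length_curve_segment[of x y G] ab unfolding upper_gradient_def by fastforce
qed

text \<open>A function in \<open>L\<^sup>p\<close> is integrable on compact intervals, so that no segment is exceptional.\<close>

lemma weak_upper_gradient_gap_le_integral: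
  assumes k: "weak_upper_gradient p M I u k" and ab: "{a..b} \<subseteq> I"
  shows "gap_le_integral u k a b"
proof (rule gap_le_integral_if_ug_inequality)
  have IB: "I \<in> sets borel" by (rule is_interval_borel[OF I])
  have "k \<in> borel_measurable (lebesgue_on I)"
    using k borel_measurable_restrict_space_eq[OF IB order.refl] by (auto simp: weak_upper_gradient_def)
  then show "k \<in> borel_measurable (lebesgue_on {a..b})"
    by (rule measurable_restrict_mono) fact
  obtain \<rho> where \<rho>: "in_Lp p M I \<rho>"
    "\<And>\<gamma> l. arc_length_curve I \<gamma> l \<Longrightarrow> \<not> ug_inequality u k \<gamma> l \<Longrightarrow> line_integral \<rho> \<gamma> l = \<infinity>"
    using k unfolding weak_upper_gradient_def exceptional_family_def by auto
  have \<rho>_meas: "\<rho> \<in> borel_measurable (lebesgue_on I)"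
    using \<rho>(1) in_Lp_iff[OF IB order.refl] by simp
  fix x y assume xy: "a \<le> x" "x < y" "y \<le> b"
  have sub: "{x..y} \<subseteq> I" using xy ab by auto
  have "line_integral \<rho> (\<lambda>s. x + s) (y - x) = (\<integral>\<^sup>+t. \<rho> t \<partial>lebesgue_on {x..y})"
    by (intro line_integral_segment measurable_restrict_mono[OF \<rho>_meas] sub)
  also have "\<dots> = (\<integral>\<^sup>+t\<in>{x..y}. \<rho> t \<partial>lebesgue)"
    by (subst nn_integral_restrict_space) auto
  also have "\<dots> < \<infinity>"
    using in_Lp_imp_integrable_on_Icc[OF \<rho>(1) IB order.refl _ sub] xy by (simp add: integrable_on_Icc_def)
  finally have "line_integral \<rho> (\<lambda>s. x + s) (y - x) \<noteq> \<infinity>" by simp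
  then show "ug_inequality u k (\<lambda>s. x + s) (y - x)"
    using \<rho>(2)[OF arc_length_curve_segment[OF xy(2) sub]] by blast
qed

lemma Newtonian_loc_gap_le_integral:
  assumes u: "Newtonian_loc p M I u" and ab: "a \<le> b" "{a..b} \<subseteq> I"
  obtains h where "integrable_on_Icc h a b" "gap_le_integral u h a b"
proof -
  have "\<exists>h. integrable_on_Icc h a b \<and> gap_le_integral u h a b"
  proof (rule near_each_point_Icc[OF u[unfolded Newtonian_loc_def] ab])
    fix G c d assume G: "openin (top_of_set I) G" and N: "Newtonian p M G u" and cd: "c \<le> d" "{c..d} \<subseteq> G"
    obtain g where g: "upper_gradient G u g" "in_Lp p M G g"
      using N unfolding Newtonian_def by auto
    have "integrable_on_Icc g c d" "gap_le_integral u g c d"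
      using G cd in_Lp_imp_integrable_on_Icc[OF g(2)] upper_gradient_gap_le_integral[OF g(1)]
        borel_if_openin[OF G] openin_imp_subset[OF G] by auto
    then show "\<exists>h. integrable_on_Icc h c d \<and> gap_le_integral u h c d" by blast
  next
    fix c d e assume "c \<le> d" "d \<le> e" "\<exists>h. integrable_on_Icc h c d \<and> gap_le_integral u h c d"
      "\<exists>h. integrable_on_Icc h d e \<and> gap_le_integral u h d e"
    then show "\<exists>h. integrable_on_Icc h c e \<and> gap_le_integral u h c e"
      by (meson gap_le_integral_combine)
  qed
  then show ?thesis using that by blast
qed

end

text \<open>A Borel substitute for the absolute value of the derivative, defined at every point:
  along a fixed sequence of steps the limsup of difference quotients involves countably many Borel
  functions.\<close>

definition upper_right_slope :: "(real \<Rightarrow> real) \<Rightarrow> real \<Rightarrow> ennreal" where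
  "upper_right_slope V x =
     limsup (\<lambda>n. ennreal \<bar>(V (x + inverse (real (Suc n))) - V x) / inverse (real (Suc n))\<bar>)"

lemma borel_measurable_upper_right_slope:
  assumes [measurable]: "V \<in> borel_measurable borel"
  shows "upper_right_slope V \<in> borel_measurable borel"
  unfolding upper_right_slope_def by measurable

lemma upper_right_slope_eq:
  assumes "(V has_real_derivative D) (at x)"
  shows "upper_right_slope V x = ennreal \<bar>D\<bar>"
proof -
  have "filterlim (\<lambda>n. inverse (real (Suc n))) (at 0) sequentially"
    using LIMSEQ_inverse_real_of_nat by (intro filterlim_atI) auto
  with assms have "(\<lambda>n. (V (x + inverse (real (Suc n))) - V x) / inverse (real (Suc n))) \<longlonglongrightarrow> D"
    unfolding DERIV_def by (rule filterlim_compose)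
  then have "(\<lambda>n. ennreal \<bar>(V (x + inverse (real (Suc n))) - V x) / inverse (real (Suc n))\<bar>)
      \<longlonglongrightarrow> ennreal \<bar>D\<bar>"
    by (intro tendsto_ennrealI tendsto_rabs)
  then show ?thesis
    unfolding upper_right_slope_def by (intro lim_imp_Limsup) auto
qed

section \<open>The slope of \<open>u\<close> as minimal weak upper gradient\<close>

locale weighted_interval_Newtonian = weighted_interval +
  fixes u :: "real \<Rightarrow> ereal"
  assumes nondegenerate: "\<exists>a\<in>I. \<exists>b\<in>I. a < b"
    and u: "Newtonian_loc p M I u"
begin

abbreviation U :: "real \<Rightarrow> real" where
  "U x \<equiv> real_of_ereal (u x)"

lemma I_borel: "I \<in> sets borel"
  by (rule is_interval_borel[OF I])

lemma Icc_subset: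
  assumes "a \<in> I" "b \<in> I"
  shows "{a..b} \<subseteq> I"
proof
  fix x assume "x \<in> {a..b}"
  then have "a \<le> x" "x \<le> b" by simp_all
  then show "x \<in> I" by (rule mem_is_interval_1_I[OF I assms])
qed

lemma u_finite:
  assumes "x \<in> I"
  shows "\<bar>u x\<bar> \<noteq> \<infinity>"
proof -
  obtain y where y: "y \<in> I" "y \<noteq> x" using nondegenerate by (metis less_irrefl)
  define a b where "a = min x y" and "b = max x y"
  have ab: "a < b" "{a..b} \<subseteq> I" "x \<in> {a..b}"
    using y assms Icc_subset by (auto simp: a_def b_def min_def max_def)
  obtain h where "integrable_on_Icc h a b" "gap_le_integral u h a b"
    using Newtonian_loc_gap_le_integral[OF u less_imp_le[OF ab(1)] ab(2)] .
  then show ?thesis using ab(1,3) by (rule gap_le_integral_finite)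
qed

lemma increments_dominated:
  assumes "a < b" "{a..b} \<subseteq> I"
  obtains H :: "real \<Rightarrow> real" where "integrable lborel H" "\<And>x. 0 \<le> H x"
    "\<And>x y. a \<le> x \<Longrightarrow> x \<le> y \<Longrightarrow> y \<le> b \<Longrightarrow> \<bar>U y - U x\<bar> \<le> (LINT t:{x..y}|lborel. H t)"
proof -
  obtain h where h: "integrable_on_Icc h a b" "gap_le_integral u h a b"
    using Newtonian_loc_gap_le_integral[OF u less_imp_le[OF assms(1)] assms(2)] .
  show ?thesis
  proof (rule gap_le_integral_real[OF h assms(1)])
    fix H :: "real \<Rightarrow> real"
    assume "integrable lborel H" "\<And>x. 0 \<le> H x"
      "\<And>x y. a \<le> x \<Longrightarrow> x \<le> y \<Longrightarrow> y \<le> b \<Longrightarrow> \<bar>U y - U x\<bar> \<le> (LINT t:{x..y}|lborel. H t)"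
    then show ?thesis by (rule that)
  qed
qed

lemma abs_continuous_on_U:
  assumes "a \<le> b" "{a..b} \<subseteq> I"
  shows "abs_continuous_on a b U"
proof (cases "a = b")
  case True
  have "(\<Sum>i<n. \<bar>U (t i) - U (s i)\<bar>) = 0"
    if "\<forall>i<n. a \<le> s i \<and> s i \<le> t i \<and> t i \<le> b" for n :: nat and s t
  proof (rule sum.neutral, intro ballI)
    fix i assume "i \<in> {..<n}"
    then have "t i = s i" using that True by (metis antisym lessThan_iff order.trans)
    then show "\<bar>U (t i) - U (s i)\<bar> = 0" by simp
  qed
  then show ?thesis unfolding abs_continuous_on_def by (metis zero_less_one)
next
  case False
  then have "a < b" using assms(1) by simp
  then show ?thesis
    using assms(2) abs_continuous_on_if_increments_le by (rule increments_dominated)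
qed

lemma U_eq_integral:
  assumes "a < b" "{a..b} \<subseteq> I"
  obtains f :: "real \<Rightarrow> real" where "integrable lborel f"
    "\<And>x y. a \<le> x \<Longrightarrow> x \<le> y \<Longrightarrow> y \<le> b \<Longrightarrow> U y - U x = (LINT t:{x..y}|lborel. f t)"
    "AE x in lebesgue. x \<in> {a<..<b} \<longrightarrow> (U has_real_derivative f x) (at x)"
proof -
  show ?thesis
  proof (rule increments_dominated[OF assms])
    fix H :: "real \<Rightarrow> real"
    assume H: "integrable lborel H" "\<And>x. 0 \<le> H x"
      "\<And>x y. a \<le> x \<Longrightarrow> x \<le> y \<Longrightarrow> y \<le> b \<Longrightarrow> \<bar>U y - U x\<bar> \<le> (LINT t:{x..y}|lborel. H t)"
    show ?thesis
    proof (rule increments_eq_integral[OF H(1,2) less_imp_le[OF assms(1)] H(3)])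
      fix f :: "real \<Rightarrow> real"
      assume f: "integrable lborel f"
        "\<And>x y. a \<le> x \<Longrightarrow> x \<le> y \<Longrightarrow> y \<le> b \<Longrightarrow> U y - U x = (LINT t:{x..y}|lborel. f t)"
      show ?thesis
        using f AE_has_real_derivative_indefinite_integral[OF f] by (rule that)
    qed
  qed
qed

text \<open>Outside \<open>I\<close> the values of \<open>u\<close> are arbitrary, so the function
  is cut off to be Borel. Since the interior is open, the cutoff does not affect derivatives at its
  points.\<close>

definition g :: "real \<Rightarrow> ennreal" where
  "g = upper_right_slope (\<lambda>x. if x \<in> interior I then U x else 0)"

lemma g_borel [measurable]: "g \<in> borel_measurable borel"
proof -
  have "continuous_on (interior I) U"
  proof (intro continuous_at_imp_continuous_on ballI)
    fix x assume "x \<in> interior I"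
    then obtain e where e: "0 < e" "cball x e \<subseteq> I" by (auto simp: mem_interior_cball)
    then have "{x - e..x + e} \<subseteq> I" by (simp add: cball_eq_atLeastAtMost)
    then have "continuous_on {x - e..x + e} U"
      using e(1) by (intro abs_continuous_on_imp_continuous_on abs_continuous_on_U) auto
    then show "isCont U x"
      by (rule continuous_on_interior) (use e(1) in simp)
  qed
  then have "(\<lambda>x. if x \<in> interior I then U x else 0) \<in> borel_measurable borel"
    by (intro borel_measurable_continuous_on_if) auto
  then show ?thesis unfolding g_def by (rule borel_measurable_upper_right_slope)
qed

lemma g_eq:
  assumes "x \<in> interior I" "(U has_real_derivative D) (at x)"
  shows "g x = ennreal \<bar>D\<bar>"
  unfolding g_def using assms
  by (intro upper_right_slope_eq)
    (auto intro: has_field_derivative_transform_within_open[where f = U and S = "interior I"])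

lemma AE_derivative:
  "AE x in lebesgue. x \<in> I \<longrightarrow> (\<exists>D. (U has_real_derivative D) (at x) \<and> g x = ennreal \<bar>D\<bar>)"
proof -
  have "AE x in lebesgue. x \<in> interior I \<longrightarrow> (\<exists>D. (U has_real_derivative D) (at x))"
  proof (rule AE_interior_if_AE_Ioo)
    fix c d assume "c < d" "{c..d} \<subseteq> I"
    then obtain f where "AE x in lebesgue. x \<in> {c<..<d} \<longrightarrow> (U has_real_derivative f x) (at x)"
      by (rule U_eq_integral)
    then show "AE x in lebesgue. x \<in> {c<..<d} \<longrightarrow> (\<exists>D. (U has_real_derivative D) (at x))"
      by eventually_elim blast
  qed
  then show ?thesis
    using AE_interior_if_interval[OF I openin_subtopology_self]
  proof eventually_elim
    case (elim x)
    show ?case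
    proof
      assume "x \<in> I"
      then have x: "x \<in> interior I" using elim(2) by (rule rev_mp)
      with elim(1) obtain D where "(U has_real_derivative D) (at x)" by (elim impE exE)
      with g_eq[OF x this] show "\<exists>D. (U has_real_derivative D) (at x) \<and> g x = ennreal \<bar>D\<bar>"
        by (intro exI conjI)
    qed
  qed
qed

text \<open>The set \<open>G\<close> is a parameter because there are two uses: small neighbourhoods
  with local upper gradients, to place \<open>g\<close> locally in L^p, and \<open>G = I\<close>
  with weak upper gradients, to prove minimality.\<close>

lemma AE_g_le:
  assumes G: "openin (top_of_set I) G"
    and k: "\<And>c d. c < d \<Longrightarrow> {c..d} \<subseteq> G \<Longrightarrow> integrable_on_Icc k c d \<and> gap_le_integral u k c d"
  shows "AE x in lebesgue. x \<in> G \<longrightarrow> g x \<le> k x"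
proof -
  \<comment> \<open>Differentiability is carried along as a premise at each point and discharged at
    the end by \<open>AE_derivative\<close>.\<close>
  have "AE x in lebesgue. x \<in> interior G \<longrightarrow>
      (x \<in> I \<longrightarrow> (\<exists>D. (U has_real_derivative D) (at x) \<and> g x = ennreal \<bar>D\<bar>)) \<longrightarrow> g x \<le> k x"
  proof (rule AE_interior_if_AE_Ioo)
    fix c d assume cd: "c < d" "{c..d} \<subseteq> G"
    show "AE x in lebesgue. x \<in> {c<..<d} \<longrightarrow>
        (x \<in> I \<longrightarrow> (\<exists>D. (U has_real_derivative D) (at x) \<and> g x = ennreal \<bar>D\<bar>)) \<longrightarrow> g x \<le> k x"
    proof (rule gap_le_integral_real[OF conjunct1[OF k[OF cd]] conjunct2[OF k[OF cd]] cd(1)])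
      fix K assume K: "integrable lborel K"
        "AE x in lebesgue. x \<in> {c..d} \<longrightarrow> k x = ennreal (K x)"
        "\<And>x y. c \<le> x \<Longrightarrow> x \<le> y \<Longrightarrow> y \<le> d \<Longrightarrow> \<bar>U y - U x\<bar> \<le> (LINT t:{x..y}|lborel. K t)"
      have "AE x in lebesgue. x \<in> {c<..<d} \<longrightarrow> (\<forall>D. (U has_real_derivative D) (at x) \<longrightarrow> \<bar>D\<bar> \<le> K x)"
        using K(1,3) by (rule AE_abs_derivative_le)
      then show "AE x in lebesgue. x \<in> {c<..<d} \<longrightarrow>
          (x \<in> I \<longrightarrow> (\<exists>D. (U has_real_derivative D) (at x) \<and> g x = ennreal \<bar>D\<bar>)) \<longrightarrow> g x \<le> k x"
        using K(2)
      proof eventually_elim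
        case (elim x)
        show ?case
        proof (intro impI)
          assume x: "x \<in> {c<..<d}"
            and "x \<in> I \<longrightarrow> (\<exists>D. (U has_real_derivative D) (at x) \<and> g x = ennreal \<bar>D\<bar>)"
          moreover have "x \<in> I"
          proof -
            have "x \<in> {c..d}" using x by simp
            then show ?thesis using cd(2) openin_imp_subset[OF G] by blast
          qed
          ultimately obtain D where "(U has_real_derivative D) (at x)" "g x = ennreal \<bar>D\<bar>" by blast
          then show "g x \<le> k x" using elim x by (auto intro!: ennreal_leI)
        qed
      qed
    qed
  qed
  then show ?thesis
    using AE_derivative AE_interior_if_interval[OF I G]
    by eventually_elim iprover
qed

lemma upper_gradient_g: "upper_gradient I u g"
  unfolding upper_gradient_def
proof (intro conjI allI impI)
  show "g \<in> borel_measurable (restrict_space borel I)"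
    by (rule measurable_restrict_space1) measurable
  fix \<gamma> l assume \<gamma>: "arc_length_curve I \<gamma> l"
  then have l: "0 < l" and cont: "continuous_on {0..l} \<gamma>" and img: "\<gamma> ` {0..l} \<subseteq> I"
    by (auto simp: arc_length_curve_def)
  define a b where "a = min (\<gamma> 0) (\<gamma> l)" and "b = max (\<gamma> 0) (\<gamma> l)"
  have \<gamma>I: "\<gamma> 0 \<in> I" "\<gamma> l \<in> I" using img l by auto
  have "ereal_gap (u (\<gamma> 0)) (u (\<gamma> l)) \<le> (\<integral>\<^sup>+x\<in>{a..b}. g x \<partial>lborel)"
  \<comment> \<open>A curve may return to its starting point; its gap is then 0 because
    \<open>u\<close> is finite there.\<close>
  proof (cases "a = b")
    case True
    then have "\<gamma> 0 = \<gamma> l" by (auto simp: a_def b_def min_def max_def split: if_splits)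
    then show ?thesis using u_finite \<gamma>I by (simp add: ereal_gap_eq)
  next
    case False
    have ab: "a < b" "{a..b} \<subseteq> I"
      using False \<gamma>I Icc_subset by (auto simp: a_def b_def min_def max_def split: if_splits)
    obtain f :: "real \<Rightarrow> real" where f: "integrable lborel f"
      "\<And>x y. a \<le> x \<Longrightarrow> x \<le> y \<Longrightarrow> y \<le> b \<Longrightarrow> U y - U x = (LINT t:{x..y}|lborel. f t)"
      "AE x in lebesgue. x \<in> {a<..<b} \<longrightarrow> (U has_real_derivative f x) (at x)"
      by (rule U_eq_integral[OF ab]) blast
    have "{a<..<b} \<subseteq> interior I"
      using ab(2) by (intro interior_maximal) (auto simp: subset_iff)
    then have "AE x in lebesgue. x \<in> {a<..<b} \<longrightarrow> g x = ennreal \<bar>f x\<bar>"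
      using f(3) by (auto elim!: eventually_mono intro: g_eq)
    then have g_f: "AE x in lborel. x \<in> {a<..<b} \<longrightarrow> g x = ennreal \<bar>f x\<bar>"
      by (simp add: AE_completion_iff)
    have "ereal_gap (u (\<gamma> 0)) (u (\<gamma> l)) = ennreal \<bar>U b - U a\<bar>"
      using u_finite \<gamma>I by (auto simp: ereal_gap_eq a_def b_def min_def max_def abs_minus_commute)
    also have "\<dots> \<le> ennreal (LINT t:{a..b}|lborel. \<bar>f t\<bar>)"
    proof (rule ennreal_leI)
      have "U b - U a = (LINT t|lborel. indicator {a..b} t *\<^sub>R f t)"
        using f(2)[of a b] ab(1) by (simp add: set_lebesgue_integral_def)
      moreover have "\<bar>\<dots>\<bar> \<le> (LINT t|lborel. \<bar>indicator {a..b} t *\<^sub>R f t\<bar>)"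
        by (rule integral_abs_bound)
      ultimately show "\<bar>U b - U a\<bar> \<le> (LINT t:{a..b}|lborel. \<bar>f t\<bar>)"
        by (simp add: set_lebesgue_integral_def abs_mult)
    qed
    also have "\<dots> = (\<integral>\<^sup>+t. ennreal (indicator {a..b} t *\<^sub>R \<bar>f t\<bar>) \<partial>lborel)"
      unfolding set_lebesgue_integral_def using f(1)
      by (intro nn_integral_eq_integral[symmetric] integrable_mult_indicator integrable_abs) auto
    also have "\<dots> = (\<integral>\<^sup>+x\<in>{a..b}. g x \<partial>lborel)"
    proof (rule nn_integral_cong_AE)
      show "AE t in lborel. ennreal (indicator {a..b} t *\<^sub>R \<bar>f t\<bar>) = g t * indicator {a..b} t"
        using g_f AE_lborel_singleton[of a] AE_lborel_singleton[of b]
        by eventually_elim (auto split: split_indicator)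
    qed
    finally show ?thesis .
  qed
  also have "\<dots> \<le> line_integral g \<gamma> l"
    unfolding a_def b_def using l
    by (intro nn_integral_le_line_integral arc_length_curve_lipschitz[OF \<gamma>] cont) auto
  finally have "ereal_gap (u (\<gamma> 0)) (u (\<gamma> l)) \<le> line_integral g \<gamma> l" .
  \<comment> \<open>Here Borel measurability of \<open>g\<close> enters: composing a merely Lebesgue
    measurable function with a curve need not give a measurable one.\<close>
  moreover have "(\<lambda>s. g (\<gamma> s)) \<in> borel_measurable (lebesgue_on {0..l})"
  proof -
    have "\<gamma> \<in> borel_measurable (lebesgue_on {0..l})"
      using cont by (intro continuous_imp_measurable_on_sets_lebesgue) auto
    then show ?thesis using g_borel by (rule measurable_compose)
  qed
  ultimately show "ug_inequality u g \<gamma> l" unfolding ug_inequality_def by blast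
qed

lemma in_Lp_loc_g: "in_Lp_loc p M I g"
  unfolding in_Lp_loc_def near_each_point_def
proof
  fix x assume "x \<in> I"
  have "\<forall>x\<in>I. \<exists>G. openin (top_of_set I) G \<and> x \<in> G \<and> Newtonian p M G u"
    using u by (simp only: Newtonian_loc_def near_each_point_def)
  from bspec[OF this \<open>x \<in> I\<close>]
  obtain G where G: "openin (top_of_set I) G" "x \<in> G" "Newtonian p M G u" by (elim exE conjE)
  from G(3) obtain k where k: "upper_gradient G u k" "in_Lp p M G k"
    unfolding Newtonian_def by (elim exE conjE)
  have GB: "G \<in> sets borel" "G \<subseteq> I" using borel_if_openin[OF G(1)] openin_imp_subset[OF G(1)] by auto
  have "AE x in lebesgue. x \<in> G \<longrightarrow> g x \<le> k x"
    using in_Lp_imp_integrable_on_Icc[OF k(2) GB] upper_gradient_gap_le_integral[OF k(1) GB(1)]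
    by (intro AE_g_le G(1)) auto
  then have "AE x in restrict_space M G. g x \<le> k x"
    by (simp add: AE_restrict_space_iff[OF GB])
  then have "AE x in restrict_space M G. epow (g x) p \<le> epow (k x) p"
    by eventually_elim (use p in \<open>auto intro: epow_mono\<close>)
  then have "(\<integral>\<^sup>+x. epow (g x) p \<partial>restrict_space M G) \<le> (\<integral>\<^sup>+x. epow (k x) p \<partial>restrict_space M G)"
    by (rule nn_integral_mono_AE)
  also have "\<dots> < \<infinity>" using k(2) by (simp add: in_Lp_def)
  finally have "in_Lp p M G g"
    using borel_measurable_lebesgue_on[OF measurable_restrict_space1[OF g_borel] GB(1)]
    by (simp add: in_Lp_def borel_measurable_restrict_space_eq[OF GB])
  with G show "\<exists>G. openin (top_of_set I) G \<and> x \<in> G \<and> in_Lp p M G g" by blast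
qed

lemma is_minimal_g: "is_minimal_weak_upper_gradient p M I u g"
  unfolding is_minimal_weak_upper_gradient_def
proof (intro conjI allI impI in_Lp_loc_g)
  show "weak_upper_gradient p M I u g"
    unfolding weak_upper_gradient_def
  proof
    show "g \<in> borel_measurable (restrict_space M I)"
      using borel_measurable_lebesgue_on[OF measurable_restrict_space1[OF g_borel] I_borel]
      by (simp add: borel_measurable_restrict_space_eq[OF I_borel order.refl])
    \<comment> \<open>\<open>g\<close> satisfies the inequality along every curve, so the
      exceptional family is empty and zero is a witness for it.\<close>
    have "in_Lp p M I (\<lambda>_. 0)" using p by (simp add: in_Lp_def epow_zero)
    then show "exceptional_family p M I {(\<gamma>, l). arc_length_curve I \<gamma> l \<and> \<not> ug_inequality u g \<gamma> l}"
      using upper_gradient_g unfolding exceptional_family_def upper_gradient_def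
      by (intro exI[of _ "\<lambda>_. 0"]) auto
  qed
  fix h assume h: "weak_upper_gradient p M I u h \<and> in_Lp_loc p M I h"
  have "AE x in lebesgue. x \<in> I \<longrightarrow> g x \<le> h x"
    using h by (intro AE_g_le) (auto intro: in_Lp_loc_imp_integrable_on_Icc weak_upper_gradient_gap_le_integral)
  then show "AE x in restrict_space M I. g x \<le> h x"
    by (simp add: AE_restrict_space_iff[OF I_borel order.refl])
qed

end

theorem proposition1p3:
  fixes M :: "real measure" and w :: "real \<Rightarrow> ennreal" and p :: real
    and I :: "real set" and u :: "real \<Rightarrow> ereal"
  assumes "measure_on_R M"
    and "1 < p"
    and "is_interval I" and "\<exists>a\<in>I. \<exists>b\<in>I. a < b"
    and "w \<in> borel_measurable lebesgue"
    and "M = completion (density lebesgue w)"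
    and "in_Lp_loc 1 lebesgue I w"
    and "in_Lp_loc 1 lebesgue I (\<lambda>x. epow (w x) (1 / (1 - p)))"
    and "Newtonian_loc p M I u"
  shows "loc_abs_continuous_on I u \<and>
    is_minimal_weak_upper_gradient p M I u (minimal_weak_upper_gradient p M I u) \<and>
    (AE x in restrict_space M I. \<exists>D.
       ((\<lambda>y. real_of_ereal (u y)) has_real_derivative D) (at x within I) \<and>
       minimal_weak_upper_gradient p M I u x = ennreal \<bar>D\<bar>)"
proof -
  interpret weighted_interval_Newtonian M w p I u
    using assms by unfold_locales
  let ?m = "minimal_weak_upper_gradient p M I u"
  \<comment> \<open>\<open>g\<close> shows that a minimal function exists, so the one selected by
    \<open>SOME\<close> is minimal too. The two bound each other almost everywhere, which transfers
    the value \<open>\<bar>D\<bar>\<close> from \<open>g\<close>.\<close>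
  have min: "is_minimal_weak_upper_gradient p M I u ?m"
    unfolding minimal_weak_upper_gradient_def using is_minimal_g
    by (rule someI[where P = "is_minimal_weak_upper_gradient p M I u"])
  have "AE x in restrict_space M I. g x \<le> ?m x" "AE x in restrict_space M I. ?m x \<le> g x"
    using min is_minimal_g unfolding is_minimal_weak_upper_gradient_def by blast+
  moreover have "AE x in restrict_space M I.
      \<exists>D. ((\<lambda>y. real_of_ereal (u y)) has_real_derivative D) (at x) \<and> g x = ennreal \<bar>D\<bar>"
    using AE_derivative by (simp add: AE_restrict_space_iff[OF I_borel order.refl])
  ultimately have "AE x in restrict_space M I. \<exists>D.
       ((\<lambda>y. real_of_ereal (u y)) has_real_derivative D) (at x within I) \<and> ?m x = ennreal \<bar>D\<bar>"
    by eventually_elim (metis antisym has_field_derivative_at_within)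
  moreover have "loc_abs_continuous_on I u"
    unfolding loc_abs_continuous_on_def
    by (intro conjI ballI allI impI u_finite abs_continuous_on_U) auto
  ultimately show ?thesis using min by (intro conjI)
qed

end
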